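(* Let $G$ be a $\sigma$-compact, locally compact, unimodular amenable group generated by a subset $Q\subset G$, and suppose that $(F_N)_{N\ge 1}$ is a symmetric F{\o}lner sequence for $G$. Let $\pi : G\to\mathcal{B}(\mathcal{H})$ be a (strongly) continuous representation of $G$ by invertible operators on a complex Hilbert space $\mathcal{H}$. Suppose that there is a constant $C\ge 1$ such that for every $N\ge 1$ and every $x\in\mathcal{H}$, $$\frac{1}{|F_N|}\int_{F_N}\|\pi(g)x\|^2\,\mathrm{d}m(g)\le C^2\|x\|^2$$ and $$\frac{1}{|F_N|}\int_{F_N}\|\pi(g)^{*}x\|^2\,\mathrm{d}m(g)\le C^2\|x\|^2,$$ and that $$\lim_{N\to\infty}\frac{1}{|F_N|}\int_{F_Ns\,\triangle\,F_N}\|\pi(g)\|^2\,\mathrm{d}m(g)=0$$ for every $s\in Q$. Then $\pi$ is unitarizable, and there exists an invertible $L\in\mathcal{B}(\mathcal{H})$ with $\|L^{-1}\|\,\|L\|\le C^2$ such that $L^{-1}\pi L$ is a unitary representation of $G$.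
   Context: $m$ denotes a right invariant Haar measure on $G$, and $|E|=m(E)$ for measurable $E\subset G$. For $A,B\subset G$ and $s\in G$: $A^{-1}=\{a^{-1}:a\in A\}$, $As=\{as:a\in A\}$, and $A\triangle B=(A\setminus B)\cup(B\setminus A)$. A symmetric F{\o}lner sequence is a sequence $(F_N)_{N\ge1}$ of compact subsets of $G$ with $0<|F_N|<\infty$, $F_N^{-1}=F_N$, and $$\lim_{N\to\infty}\frac{|F_Ns\,\triangle\,F_N|}{|F_N|}=0\quad\text{for every } s\in G.$$ $\mathcal{B}(\mathcal{H})$ is the algebra of bounded linear operators on $\mathcal{H}$. A continuous representation of $G$ is a map $\pi:G\to\mathcal{B}(\mathcal{H})$ with $\pi(1)=I$, $\pi(g_1g_2)=\pi(g_1)\pi(g_2)$ for all $g_1,g_2\in G$, continuous for the strong operator topology on $\mathcal{B}(\mathcal{H})$. It is a unitary representation if $\pi(g)^*\pi(g)=I=\pi(g)\pi(g)^*$ for all $g\in G$. $\pi$ is unitarizable if there is an invertible $L\in\mathcal{B}(\mathcal{H})$ such that $g\mapsto L^{-1}\pi(g)L$ (denoted $L^{-1}\pi L$) is a unitary representation. *)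

theory Defs
  imports "HOL-Analysis.Analysis"
begin

text \<open>
  Groups are types of the library class \<open>topological_group_add\<close>. This class does not
  assume commutativity; only the notation is additive: \<open>a + b\<close> is the product, \<open>0\<close> the
  neutral element and \<open>- a\<close> the inverse. In particular \<open>(\<lambda>a. a + s) ` A\<close> is the right
  translate $As$ and \<open>uminus ` A\<close> is $A^{-1}$. Locally compact groups are Hausdorff, which is
  expressed by the additional sort \<open>t2_space\<close>.
\<close>

definition add_subgroup :: "'g::group_add set \<Rightarrow> bool" where
  "add_subgroup H \<longleftrightarrow> 0 \<in> H \<and> (\<forall>a\<in>H. \<forall>b\<in>H. a + b \<in> H) \<and> (\<forall>a\<in>H. - a \<in> H)"

definition generates_group :: "'g::group_add set \<Rightarrow> bool" where
  "generates_group Q \<longleftrightarrow> add_subgroup hull Q = UNIV"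

definition sigma_compact :: "'a::topological_space set \<Rightarrow> bool" where
  "sigma_compact S \<longleftrightarrow> (\<exists>K :: nat \<Rightarrow> 'a set. (\<forall>n. compact (K n)) \<and> (\<Union>n. K n) = S)"

definition radon_measure :: "'a::topological_space measure \<Rightarrow> bool" where
  "radon_measure m \<longleftrightarrow>
     sets m = sets borel \<and>
     (\<forall>K. compact K \<longrightarrow> emeasure m K < \<infinity>) \<and>
     (\<forall>A\<in>sets borel. emeasure m A = (INF U\<in>{U. open U \<and> A \<subseteq> U}. emeasure m U)) \<and>
     (\<forall>U. open U \<longrightarrow> emeasure m U = (SUP K\<in>{K. compact K \<and> K \<subseteq> U}. emeasure m K))"

definition right_haar_measure :: "'g::topological_group_add measure \<Rightarrow> bool" where
  "right_haar_measure m \<longleftrightarrow>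
     radon_measure m \<and> emeasure m UNIV \<noteq> 0 \<and>
     (\<forall>s. \<forall>A\<in>sets borel. emeasure m ((\<lambda>a. a + s) ` A) = emeasure m A)"

text \<open>
  The next two notions are properties of the group. They are phrased relative to a right Haar
  measure \<open>m\<close>, but do not depend on its choice, since \<open>m\<close> is unique up to a positive factor.
\<close>

definition unimodular :: "'g::topological_group_add measure \<Rightarrow> bool" where
  "unimodular m \<longleftrightarrow> (\<forall>s. \<forall>A\<in>sets borel. emeasure m ((\<lambda>a. s + a) ` A) = emeasure m A)"

definition Linfty :: "'g measure \<Rightarrow> ('g \<Rightarrow> real) set" where
  "Linfty m = {f \<in> borel_measurable m. \<exists>c. AE x in m. \<bar>f x\<bar> \<le> c}"

text \<open>
  An invariant mean on $L^\infty(G)$, as a functional on representatives. Positivity is required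
  modulo null sets, so (by linearity) \<open>M\<close> takes the same value on functions that agree
  almost everywhere.
\<close>

definition left_invariant_mean ::
    "'g::topological_group_add measure \<Rightarrow> (('g \<Rightarrow> real) \<Rightarrow> real) \<Rightarrow> bool" where
  "left_invariant_mean m M \<longleftrightarrow>
     (\<forall>f\<in>Linfty m. \<forall>h\<in>Linfty m. M (\<lambda>x. f x + h x) = M f + M h) \<and>
     (\<forall>c. \<forall>f\<in>Linfty m. M (\<lambda>x. c * f x) = c * M f) \<and>
     (\<forall>f\<in>Linfty m. (AE x in m. 0 \<le> f x) \<longrightarrow> 0 \<le> M f) \<and>
     M (\<lambda>_. 1) = 1 \<and>
     (\<forall>s. \<forall>f\<in>Linfty m. M (\<lambda>x. f (s + x)) = M f)"

definition amenable :: "'g::topological_group_add measure \<Rightarrow> bool" where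
  "amenable m \<longleftrightarrow> (\<exists>M. left_invariant_mean m M)"

definition symmetric_Folner ::
    "'g::topological_group_add measure \<Rightarrow> (nat \<Rightarrow> 'g set) \<Rightarrow> bool" where
  "symmetric_Folner m F \<longleftrightarrow>
     (\<forall>N\<ge>1. compact (F N) \<and> 0 < emeasure m (F N) \<and> emeasure m (F N) < \<infinity>
            \<and> uminus ` F N = F N) \<and>
     (\<forall>s. (\<lambda>N. measure m (sym_diff ((\<lambda>a. a + s) ` F N) (F N)) / measure m (F N))
            \<longlonglongrightarrow> 0)"

text \<open>
  The library only has real inner product spaces. A complex one is built on top of the class
  \<open>real_inner\<close>, whose inner product is the real part of the complex one; hence norm, topology
  and completeness are the library's. The complex inner product is linear in the first argument.
\<close>

class complex_inner = real_inner +
  fixes scaleC :: "complex \<Rightarrow> 'a \<Rightarrow> 'a" (infixr \<open>*\<^sub>C\<close> 75)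
    and cinner :: "'a \<Rightarrow> 'a \<Rightarrow> complex"
  assumes scaleC_add_right: "c *\<^sub>C (x + y) = c *\<^sub>C x + c *\<^sub>C y"
    and scaleC_add_left: "(c + d) *\<^sub>C x = c *\<^sub>C x + d *\<^sub>C x"
    and scaleC_scaleC: "c *\<^sub>C d *\<^sub>C x = (c * d) *\<^sub>C x"
    and scaleC_of_real: "complex_of_real r *\<^sub>C x = r *\<^sub>R x"
    and cinner_commute: "cinner x y = cnj (cinner y x)"
    and cinner_add_left: "cinner (x + y) z = cinner x z + cinner y z"
    and cinner_scaleC_left: "cinner (c *\<^sub>C x) y = c * cinner x y"
    and Re_cinner: "Re (cinner x y) = inner x y"

class chilbert_space = complex_inner + complete_space

instantiation complex :: chilbert_space
begin

definition scaleC_complex :: "complex \<Rightarrow> complex \<Rightarrow> complex" where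
  "scaleC_complex c x = c * x"

definition cinner_complex :: "complex \<Rightarrow> complex \<Rightarrow> complex" where
  "cinner_complex x y = x * cnj y"

instance
  by standard
    (auto simp: scaleC_complex_def cinner_complex_def algebra_simps inner_complex_def scaleR_conv_of_real)

end

text \<open>
  The algebra of bounded operators consists of the complex-linear elements of the library type of
  bounded (real-)linear maps. The operator norm and the composition are those of that type.
\<close>

definition bounded_ops :: "('h::complex_inner \<Rightarrow>\<^sub>L 'h) set" where
  "bounded_ops = {T. \<forall>c x. blinfun_apply T (c *\<^sub>C x) = c *\<^sub>C blinfun_apply T x}"

definition op_adjoint :: "('h::chilbert_space \<Rightarrow>\<^sub>L 'h) \<Rightarrow> ('h \<Rightarrow>\<^sub>L 'h)" where
  "op_adjoint T = (THE S. S \<in> bounded_ops \<and>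
     (\<forall>x y. cinner (blinfun_apply T x) y = cinner x (blinfun_apply S y)))"

definition invertible_op :: "('h::complex_inner \<Rightarrow>\<^sub>L 'h) \<Rightarrow> bool" where
  "invertible_op L \<longleftrightarrow> L \<in> bounded_ops \<and>
     (\<exists>S\<in>bounded_ops. L o\<^sub>L S = id_blinfun \<and> S o\<^sub>L L = id_blinfun)"

definition op_inverse :: "('h::complex_inner \<Rightarrow>\<^sub>L 'h) \<Rightarrow> ('h \<Rightarrow>\<^sub>L 'h)" where
  "op_inverse L = (THE S. S \<in> bounded_ops \<and> L o\<^sub>L S = id_blinfun \<and> S o\<^sub>L L = id_blinfun)"

definition continuous_rep ::
    "('g::topological_group_add \<Rightarrow> ('h::chilbert_space \<Rightarrow>\<^sub>L 'h)) \<Rightarrow> bool" where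
  "continuous_rep \<pi> \<longleftrightarrow>
     (\<forall>g. \<pi> g \<in> bounded_ops) \<and>
     \<pi> 0 = id_blinfun \<and>
     (\<forall>g h. \<pi> (g + h) = \<pi> g o\<^sub>L \<pi> h) \<and>
     (\<forall>x. continuous_on UNIV (\<lambda>g. blinfun_apply (\<pi> g) x))"

definition unitary_rep ::
    "('g::topological_group_add \<Rightarrow> ('h::chilbert_space \<Rightarrow>\<^sub>L 'h)) \<Rightarrow> bool" where
  "unitary_rep \<pi> \<longleftrightarrow> continuous_rep \<pi> \<and>
     (\<forall>g. op_adjoint (\<pi> g) o\<^sub>L \<pi> g = id_blinfun \<and> \<pi> g o\<^sub>L op_adjoint (\<pi> g) = id_blinfun)"

definition conj_rep ::
    "('h::chilbert_space \<Rightarrow>\<^sub>L 'h) \<Rightarrow> ('g \<Rightarrow> ('h \<Rightarrow>\<^sub>L 'h)) \<Rightarrow> 'g \<Rightarrow> ('h \<Rightarrow>\<^sub>L 'h)" where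
  "conj_rep L \<pi> = (\<lambda>g. op_inverse L o\<^sub>L \<pi> g o\<^sub>L L)"

definition unitarizable ::
    "('g::topological_group_add \<Rightarrow> ('h::chilbert_space \<Rightarrow>\<^sub>L 'h)) \<Rightarrow> bool" where
  "unitarizable \<pi> \<longleftrightarrow> (\<exists>L. invertible_op L \<and> unitary_rep (conj_rep L \<pi>))"

end

theory Submission
  imports Defs
begin

text \<open>
  The averages of \<open>inner (\<pi> g x) (\<pi> g y)\<close> over \<open>F N\<close> form a pointwise bounded sequence of bilinear
  forms, so by Tychonoff they have a cluster point \<open>b\<close>. The first two hypotheses give
  \<open>C\<^sup>-\<^sup>2 |x|\<^sup>2 \<le> b x x \<le> C\<^sup>2 |x|\<^sup>2\<close>: for the lower bound, \<open>|x|\<^sup>2 = inner (\<pi> g x) (\<pi> (- g)\<^sup>* x)\<close> is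
  averaged over the symmetric set \<open>F N\<close>, using that a bi-invariant measure is invariant under inversion.
  The third hypothesis makes \<open>b\<close> invariant under \<open>\<pi> s\<close> for \<open>s \<in> Q\<close>, hence under the whole group.
  Writing \<open>b x y = inner x (R (R y))\<close> with \<open>R\<close> positive, \<open>R \<pi> R\<^sup>-\<^sup>1\<close> is unitary, so \<open>L = R\<^sup>-\<^sup>1\<close> works.
\<close>

section \<open>Forms and square roots on a Hilbert space\<close>

text \<open>The averages need not converge, and without separability one cannot count on a
  subsequence that converges for all pairs of vectors; the limit is therefore taken along one filter
  finer than \<open>sequentially\<close>. The form \<open>b\<close> and its square root are
  real-linear objects. Complex linearity is recovered from one fact: multiplication by the imaginary
  unit preserves \<open>b\<close>, so it commutes with \<open>S\<close> and hence with
  \<open>R\<close>. The constant arises as \<open>C * C\<close>, because the two bounds on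
  \<open>b\<close> say that \<open>R\<close> and its inverse each have norm at most
  \<open>C\<close>. Two analytic obstacles shape the rest. The integral of a non-integrable function
  is 0 by convention, so estimates between integrals must be backed by integrability; this comes
  from uniform boundedness of \<open>\<pi>\<close> on compact sets. And the lower bound needs the
  adjoint at \<open>- g\<close> where the hypothesis speaks of \<open>g\<close>. Inversion
  invariance is obtained from Fubini, on a group that may lack a countable base, so measurability of
  the kernels on the product has to be derived from sigma-compactness.\<close>

lemma riesz_representation:
  fixes f :: "'a::{real_inner, complete_space} \<Rightarrow> real"
  assumes "bounded_linear f"
  obtains z where "\<And>x. f x = inner x z"
proof -
  interpret f: bounded_linear f by fact
  \<comment> \<open>If \<open>z\<close> represents \<open>f\<close>, then \<open>J x\<close> is
    \<open>|x - z|^2 - |z|^2\<close>; so \<open>z\<close> is to be found as the minimizer of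
    \<open>J\<close>.\<close>
  define J where "J x = (norm x)\<^sup>2 - 2 * f x" for x
  obtain K where K: "\<And>x. \<bar>f x\<bar> \<le> norm x * K"
    using f.bounded by auto
  have J_ge: "- K\<^sup>2 \<le> J x" for x
  proof -
    have "0 \<le> (norm x - K)\<^sup>2" by simp
    moreover have "f x \<le> norm x * K" using K[of x] by simp
    ultimately show ?thesis by (simp add: J_def power2_diff)
  qed
  define d where "d = Inf (range J)"
  have bdd: "bdd_below (range J)" using J_ge by (auto intro!: bdd_belowI)
  have d_le: "d \<le> J x" for x
    unfolding d_def using bdd by (intro cInf_lower) auto
  have "\<exists>x. J x < d + 1 / Suc n" for n
  proof -
    have "Inf (range J) < d + 1 / Suc n" by (simp add: d_def)
    then show ?thesis
      using cInf_lessD[of "range J" "d + 1 / Suc n"] by auto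
  qed
  then obtain u where u: "\<And>n. J (u n) < d + 1 / Suc n" by metis
  \<comment> \<open>The parallelogram law compares \<open>J\<close> at two points with
    \<open>J\<close> at their midpoint, which is at least \<open>d\<close>. Near-minimizers are
    therefore close together.\<close>
  have parallelogram: "(norm (x - y))\<^sup>2 \<le> 2 * (J x - d) + 2 * (J y - d)" for x y
  proof -
    have *: "(norm (x - y))\<^sup>2 = 2 * (norm x)\<^sup>2 + 2 * (norm y)\<^sup>2 - (norm (x + y))\<^sup>2"
      by (simp add: power2_norm_eq_inner inner_add inner_diff inner_commute)
    have "4 * J ((1/2) *\<^sub>R (x + y)) = (norm (x + y))\<^sup>2 - 4 * f x - 4 * f y"
      unfolding J_def by (simp only: norm_scaleR power_mult_distrib f.scaleR f.add) (simp add: power2_eq_square field_simps)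
    with * have "(norm (x - y))\<^sup>2 = 2 * J x + 2 * J y - 4 * J ((1/2) *\<^sub>R (x + y))"
      by (simp add: J_def)
    then show ?thesis using d_le[of "(1/2) *\<^sub>R (x + y)"] by simp
  qed
  have "Cauchy u"
  proof (rule metric_CauchyI)
    fix e :: real assume "0 < e"
    then obtain M :: nat where M: "4 / e\<^sup>2 < M"
      using reals_Archimedean2 by blast
    have "0 < e\<^sup>2" using \<open>0 < e\<close> by simp
    have "dist (u i) (u j) < e" if "M \<le> i" "M \<le> j" for i j
    proof -
      have *: "1 / Suc k < e\<^sup>2 / 4" if "M \<le> k" for k
      proof -
        have "4 / e\<^sup>2 < Suc k" using M that by linarith
        then show ?thesis using \<open>0 < e\<^sup>2\<close> by (simp add: field_simps)
      qed
      have "(dist (u i) (u j))\<^sup>2 < e\<^sup>2"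
        using parallelogram[of "u i" "u j"] u[of i] u[of j] *[OF that(1)] *[OF that(2)]
        by (simp add: dist_norm)
      then show ?thesis using \<open>0 < e\<close> power_less_imp_less_base by fastforce
    qed
    then show "\<exists>M. \<forall>i\<ge>M. \<forall>j\<ge>M. dist (u i) (u j) < e" by blast
  qed
  then obtain z where z: "u \<longlonglongrightarrow> z" using Cauchy_convergent convergent_def by blast
  have "(\<lambda>n. J (u n)) \<longlonglongrightarrow> J z"
    unfolding J_def using z by (intro tendsto_intros f.tendsto)
  moreover have "(\<lambda>n. d + 1 / Suc n) \<longlonglongrightarrow> d + 0"
    by (intro tendsto_intros LIMSEQ_Suc[OF lim_1_over_n])
  ultimately have "J z \<le> d + 0"
    by (rule LIMSEQ_le) (use u less_imp_le in blast)
  then have J_z: "J z \<le> J x" for x using d_le[of x] by simp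
  have "f x = inner x z" for x
  proof -
    define D where "D = inner x z - f x"
    \<comment> \<open>The choice \<open>t = - D / n\<close> minimizes
      \<open>2 * t * D + t\<^sup>2 * n\<close>. Adding 1 keeps the denominator positive when
      \<open>x = 0\<close>.\<close>
    define n where "n = (norm x)\<^sup>2 + 1"
    have "0 < n" by (simp add: n_def add_nonneg_pos)
    define t where "t = - D / n"
    have "J (z + t *\<^sub>R x) - J z = 2 * t * D + t\<^sup>2 * (norm x)\<^sup>2"
      unfolding J_def D_def power2_norm_eq_inner
      by (simp add: f.add f.scaleR inner_add inner_commute power2_eq_square algebra_simps)
    also have "\<dots> \<le> 2 * t * D + t\<^sup>2 * n"
      by (simp add: n_def mult_left_mono)
    also have "\<dots> = - D\<^sup>2 / n"
      using \<open>0 < n\<close> by (simp add: t_def power2_eq_square field_simps)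
    finally have "0 \<le> - D\<^sup>2 / n" using J_z[of "z + t *\<^sub>R x"] by linarith
    then have "D\<^sup>2 \<le> 0" using \<open>0 < n\<close> by (simp add: field_simps)
    then show ?thesis by (simp add: D_def)
  qed
  then show thesis by (rule that)
qed

text \<open>Riesz is applied in the first argument for each fixed \<open>y\<close>. Uniqueness of
  the representing vector makes it linear in \<open>y\<close>, and testing the form against that
  vector itself bounds its norm.\<close>

lemma bounded_bilinear_representation:
  fixes b :: "'a::{real_inner, complete_space} \<Rightarrow> 'a \<Rightarrow> real"
  assumes "bounded_bilinear b"
  obtains S :: "'a \<Rightarrow>\<^sub>L 'a" where "\<And>x y. b x y = inner x (S y)"
proof -
  interpret b: bounded_bilinear b by fact
  have "\<exists>z. \<forall>x. b x y = inner x z" for y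
    using riesz_representation[OF b.bounded_linear_left] by metis
  then obtain s where s: "\<And>x y. b x y = inner x (s y)" by metis
  obtain K where K: "0 \<le> K" "\<And>x y. \<bar>b x y\<bar> \<le> norm x * norm y * K"
    using b.nonneg_bounded by auto
  have "bounded_linear s"
  proof (rule bounded_linear_intro)
    show "s (y + z) = s y + s z" for y z
      by (rule vector_eq_ldot[THEN iffD1]) (simp add: inner_add_right b.add_right flip: s)
    show "s (r *\<^sub>R y) = r *\<^sub>R s y" for r y
      by (rule vector_eq_ldot[THEN iffD1]) (simp add: b.scaleR_right flip: s)
    show "norm (s y) \<le> norm y * K" for y
    proof -
      have "norm (s y) * norm (s y) = b (s y) y"
        by (simp add: s flip: power2_norm_eq_inner power2_eq_square)
      also have "\<dots> \<le> norm (s y) * (norm y * K)" using K(2)[of "s y" y] by (simp add: mult_ac)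
      finally show ?thesis using K(1) by (cases "s y = 0") auto
    qed
  qed
  then have "b x y = inner x (Blinfun s y)" for x y
    by (simp add: s bounded_linear_Blinfun_apply)
  then show thesis by (rule that)
qed

text \<open>Polarization passes from the quadratic form to \<open>inner y (A x)\<close>. Restricting
  to vectors of equal norm makes the parallelogram law return exactly \<open>4 * a * |x|^2\<close>;
  the norm of \<open>A x\<close> is then read off by taking \<open>y\<close> to be
  \<open>A x\<close> rescaled to the length of \<open>x\<close>.\<close>

lemma symmetric_norm_le:
  fixes A :: "'a::real_inner \<Rightarrow>\<^sub>L 'a"
  assumes sym: "\<And>x y. inner (A x) y = inner x (A y)"
    and bound: "\<And>x. \<bar>inner x (A x)\<bar> \<le> a * (norm x)\<^sup>2" and "0 \<le> a"
  shows "norm A \<le> a"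
proof (rule norm_blinfun_bound[OF \<open>0 \<le> a\<close>])
  have *: "inner y (A x) \<le> a * (norm x)\<^sup>2" if "norm y = norm x" for x y
  proof -
    have "4 * inner y (A x) = inner (x + y) (A (x + y)) - inner (x - y) (A (x - y))"
      using sym[of x y]
      by (simp add: blinfun.add_right blinfun.diff_right inner_add inner_diff inner_commute)
    also have "\<dots> \<le> a * (norm (x + y))\<^sup>2 + a * (norm (x - y))\<^sup>2"
      using bound[of "x + y"] bound[of "x - y"] by linarith
    also have "\<dots> = a * (2 * (norm x)\<^sup>2 + 2 * (norm y)\<^sup>2)"
      by (simp add: power2_norm_eq_inner inner_add inner_diff inner_commute algebra_simps)
    finally show ?thesis using that by simp
  qed
  show "norm (A x) \<le> a * norm x" for x
  proof (cases "A x = 0 \<or> x = 0")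
    case True
    then show ?thesis using \<open>0 \<le> a\<close> by auto
  next
    case False
    then have "0 < norm x" "0 < norm (A x)" by auto
    have "norm x * norm (A x) = inner ((norm x / norm (A x)) *\<^sub>R A x) (A x)"
      using False by (simp add: power2_eq_square flip: power2_norm_eq_inner)
    also have "\<dots> \<le> a * (norm x)\<^sup>2" using False by (intro *) simp
    finally show ?thesis using \<open>0 < norm x\<close> by (simp add: power2_eq_square)
  qed
qed

text \<open>With \<open>A = I - S / d\<close>, the operator \<open>sqrt d (I - Y)\<close> is a square root of \<open>S\<close> if and only if
  \<open>Y = (A + Y\<^sup>2) / 2\<close>. As \<open>a = 1 - c / d\<close> bounds the norm of \<open>A\<close>, the right-hand side contracts the
  ball of radius \<open>a\<close>.\<close>

lemma positive_sqrt:
  fixes S :: "'a::{real_inner, banach} \<Rightarrow>\<^sub>L 'a"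
  assumes sym: "\<And>x y. inner (S x) y = inner x (S y)"
    and cd: "0 < c" "c \<le> d"
    and lower: "\<And>x. c * (norm x)\<^sup>2 \<le> inner x (S x)"
    and upper: "\<And>x. inner x (S x) \<le> d * (norm x)\<^sup>2"
  obtains R :: "'a \<Rightarrow>\<^sub>L 'a"
  where "\<And>x y. inner (R x) y = inner x (R y)" "R o\<^sub>L R = S" "surj (blinfun_apply R)"
    and "\<And>J. J o\<^sub>L S = S o\<^sub>L J \<Longrightarrow> J o\<^sub>L R = R o\<^sub>L J"
proof -
  have "0 < d" using cd by simp
  define a where "a = 1 - c / d"
  have a: "0 \<le> a" "a < 1" using cd by (auto simp: a_def field_simps)
  define A where "A = id_blinfun - (1 / d) *\<^sub>R S"
  have A_apply: "A x = x - (1 / d) *\<^sub>R S x" for x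
    by (simp add: A_def blinfun.diff_left blinfun.scaleR_left)
  have A_sym: "inner (A x) y = inner x (A y)" for x y
    using sym[of x y] by (simp add: A_apply inner_diff)
  have "norm A \<le> a"
  proof (rule symmetric_norm_le[OF A_sym _ a(1)])
    fix x
    have "inner x (A x) = (norm x)\<^sup>2 - inner x (S x) / d"
      by (simp add: A_apply inner_diff power2_norm_eq_inner)
    moreover have "c / d * (norm x)\<^sup>2 \<le> inner x (S x) / d" "inner x (S x) / d \<le> (norm x)\<^sup>2"
      using lower[of x] upper[of x] \<open>0 < d\<close> by (auto simp: field_simps)
    ultimately show "\<bar>inner x (A x)\<bar> \<le> a * (norm x)\<^sup>2"
      using a mult_nonneg_nonneg[OF a(1), of "(norm x)\<^sup>2"] by (simp add: a_def algebra_simps abs_le_iff)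
  qed
  \<comment> \<open>Symmetry and commutation with the commutant of \<open>S\<close> are closed
    conditions preserved by \<open>\<Phi>\<close>. Building them into the complete set hands them to
    the fixed point.\<close>
  define D where "D = {Y. norm Y \<le> a \<and> (\<forall>x y. inner (blinfun_apply Y x) y = inner x (Y y)) \<and>
    (\<forall>J. J o\<^sub>L S = S o\<^sub>L J \<longrightarrow> (\<forall>x. blinfun_apply J (Y x) = Y (J x)))}"
  define \<Phi> where "\<Phi> Y = (1 / 2) *\<^sub>R (A + (Y o\<^sub>L Y))" for Y :: "'a \<Rightarrow>\<^sub>L 'a"
  have \<Phi>_apply: "\<Phi> Y x = (1 / 2) *\<^sub>R (A x + Y (Y x))" for Y :: "'a \<Rightarrow>\<^sub>L 'a" and x
    by (simp add: \<Phi>_def blinfun.add_left blinfun.scaleR_left)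
  have "complete D"
  proof -
    have "closed D"
      unfolding D_def
      by (intro closed_Collect_conj closed_Collect_all closed_Collect_imp open_Collect_const
          closed_Collect_le closed_Collect_eq continuous_intros)
    then show ?thesis by (simp add: complete_eq_closed)
  qed
  moreover have "0 \<in> D" using a by (auto simp: D_def)
  moreover have "\<Phi> ` D \<subseteq> D"
  proof (clarify)
    fix Y assume Y: "Y \<in> D"
    have "norm (\<Phi> Y) \<le> (norm A + norm (Y o\<^sub>L Y)) / 2"
      unfolding \<Phi>_def by (simp add: norm_triangle_ineq)
    also have "\<dots> \<le> (a + a * a) / 2"
      using \<open>norm A \<le> a\<close> norm_blinfun_compose[of Y Y] mult_mono[of "norm Y" a "norm Y" a] Y a
      by (auto simp: D_def)
    also have "\<dots> \<le> a" using a mult_left_mono[of a 1 a] by simp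
    finally have 1: "norm (\<Phi> Y) \<le> a" .
    have 2: "inner (\<Phi> Y x) y = inner x (\<Phi> Y y)" for x y
      using Y A_sym[of x y] by (simp add: D_def \<Phi>_apply inner_add)
    have 3: "J (\<Phi> Y x) = \<Phi> Y (J x)" if J: "J o\<^sub>L S = S o\<^sub>L J" for J x
    proof -
      have "J (S x) = S (J x)" using J by (metis blinfun_apply_blinfun_compose)
      then show ?thesis
        using Y J by (simp add: D_def \<Phi>_apply A_apply blinfun.add_right blinfun.diff_right blinfun.scaleR_right)
    qed
    show "\<Phi> Y \<in> D" using 1 2 3 by (simp add: D_def)
  qed
  moreover have "dist (\<Phi> Y) (\<Phi> Z) \<le> a * dist Y Z" if "Y \<in> D" "Z \<in> D" for Y Z
  proof -
    \<comment> \<open>This is \<open>Y\<^sup>2 - Z\<^sup>2\<close> split without assuming that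
      \<open>Y\<close> and \<open>Z\<close> commute. With both norms at most \<open>a\<close>, the
      factor 1/2 leaves the contraction constant \<open>a\<close>.\<close>
    have "\<Phi> Y - \<Phi> Z = (1 / 2) *\<^sub>R ((Y o\<^sub>L (Y - Z)) + ((Y - Z) o\<^sub>L Z))"
      by (rule blinfun_eqI)
        (simp add: blinfun.diff_left blinfun.add_left blinfun.scaleR_left \<Phi>_apply blinfun.diff_right
          flip: scaleR_diff_right)
    then have "dist (\<Phi> Y) (\<Phi> Z) = (1 / 2) * norm ((Y o\<^sub>L (Y - Z)) + ((Y - Z) o\<^sub>L Z))"
      by (simp add: dist_norm)
    also have "\<dots> \<le> (1 / 2) * (norm Y * norm (Y - Z) + norm (Y - Z) * norm Z)"
      using norm_triangle_ineq[of "Y o\<^sub>L (Y - Z)" "(Y - Z) o\<^sub>L Z"]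
        norm_blinfun_compose[of Y "Y - Z"] norm_blinfun_compose[of "Y - Z" Z] by simp
    also have "\<dots> \<le> (1 / 2) * (a * norm (Y - Z) + norm (Y - Z) * a)"
      using that by (intro mult_left_mono add_mono mult_right_mono) (auto simp: D_def)
    finally show ?thesis by (simp add: dist_norm)
  qed
  ultimately have "\<exists>!Y\<in>D. \<Phi> Y = Y"
    using a by (intro Banach_fix) auto
  then obtain Y where "Y \<in> D" and fixpoint: "\<Phi> Y = Y" by auto
  define R where "R = sqrt d *\<^sub>R (id_blinfun - Y)"
  have R_apply: "R x = sqrt d *\<^sub>R (x - Y x)" for x
    by (simp add: R_def blinfun.diff_left blinfun.scaleR_left)
  show thesis
  proof
    show "inner (R x) y = inner x (R y)" for x y
      using \<open>Y \<in> D\<close> by (simp add: R_apply D_def inner_diff)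
    show "R o\<^sub>L R = S"
    proof (rule blinfun_eqI)
      fix x
      have "Y x = (1 / 2) *\<^sub>R (A x + Y (Y x))" using \<Phi>_apply[of Y x] fixpoint by simp
      then have "2 *\<^sub>R Y x = 2 *\<^sub>R ((1 / 2) *\<^sub>R (A x + Y (Y x)))" by (rule arg_cong)
      then have "2 *\<^sub>R Y x = A x + Y (Y x)" by simp
      then have Y2: "Y (Y x) = 2 *\<^sub>R Y x - A x" by (simp add: algebra_simps)
      have "R (R x) = (sqrt d * sqrt d) *\<^sub>R (x - Y x - (Y x - Y (Y x)))"
        unfolding R_apply blinfun.diff_right blinfun.scaleR_right
        by (simp only: scaleR_scaleR flip: scaleR_diff_right)
      also have "\<dots> = d *\<^sub>R (x - A x)" using \<open>0 < d\<close> by (simp add: Y2 scaleR_2)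
      also have "\<dots> = S x" using \<open>0 < d\<close> by (simp add: A_apply)
      finally show "(R o\<^sub>L R) x = S x" by simp
    qed
    show "surj (blinfun_apply R)"
    proof (rule surjI)
      fix y
      \<comment> \<open>Solving \<open>R x = y\<close> means finding a fixed point of
        \<open>T\<close>, a contraction because \<open>norm Y \<le> a < 1\<close>. The rule
        \<open>surjI\<close> wants a preimage as an explicit function of \<open>y\<close>, hence the
        \<open>SOME\<close> terms.\<close>
      define T where "T x = Y x + (1 / sqrt d) *\<^sub>R y" for x
      have "dist (T x) (T x') \<le> a * dist x x'" for x x'
      proof -
        have "dist (T x) (T x') = norm (Y (x - x'))" by (simp add: T_def dist_norm blinfun.diff_right)
        also have "\<dots> \<le> norm Y * norm (x - x')" by (rule norm_blinfun)
        also have "\<dots> \<le> a * dist x x'"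
          using \<open>Y \<in> D\<close> by (simp add: D_def dist_norm mult_right_mono)
        finally show ?thesis .
      qed
      then have "\<exists>x. T x = x" using banach_fix_type[of a T] a by blast
      then have "T (SOME x. T x = x) = (SOME x. T x = x)" by (rule someI_ex)
      then have "(SOME x. T x = x) - Y (SOME x. T x = x) = (1 / sqrt d) *\<^sub>R y"
        by (simp add: T_def algebra_simps)
      then show "R (SOME x. Y x + (1 / sqrt d) *\<^sub>R y = x) = y"
        using \<open>0 < d\<close> by (simp add: R_apply T_def)
    qed
    show "J o\<^sub>L R = R o\<^sub>L J" if "J o\<^sub>L S = S o\<^sub>L J" for J
      using \<open>Y \<in> D\<close> that
      by (intro blinfun_eqI) (simp add: R_apply D_def blinfun.diff_right blinfun.scaleR_right)
  qed
qed

section \<open>Operators on a complex Hilbert space\<close>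

instance chilbert_space \<subseteq> banach ..

lemma scaleC_eq: "c *\<^sub>C x = Re c *\<^sub>R x + Im c *\<^sub>R (\<i> *\<^sub>C x)"
proof -
  have "c *\<^sub>C x = (complex_of_real (Re c) + complex_of_real (Im c) * \<i>) *\<^sub>C x"
    by (metis complex_eq mult.commute)
  also have "\<dots> = Re c *\<^sub>R x + Im c *\<^sub>R (\<i> *\<^sub>C x)"
    by (simp only: scaleC_add_left scaleC_of_real flip: scaleC_scaleC)
  finally show ?thesis .
qed

text \<open>The imaginary part of a complex number is minus the real part of its product with the
  imaginary unit. Identities for the complex inner product thus reduce to real ones.\<close>

lemma cinner_eq: "cinner x y = Complex (inner x y) (- inner (\<i> *\<^sub>C x) y)"
  by (simp add: complex_eq_iff cinner_scaleC_left flip: Re_cinner)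

lemma inner_scaleC_ii [simp]: "inner (\<i> *\<^sub>C x) (\<i> *\<^sub>C y) = inner x y"
proof -
  have "cinner x (\<i> *\<^sub>C y) = cnj (\<i> * cinner y x)"
    by (metis cinner_commute cinner_scaleC_left)
  also have "\<dots> = - \<i> * cinner x y"
    using cinner_commute[of x y] by simp
  finally have "cinner (\<i> *\<^sub>C x) (\<i> *\<^sub>C y) = cinner x y"
    by (simp add: cinner_scaleC_left)
  then show ?thesis by (metis Re_cinner)
qed

lemma norm_scaleC_ii [simp]: "norm (\<i> *\<^sub>C x) = norm x"
  by (simp add: norm_eq_sqrt_inner)

lemma scaleC_ii_ii [simp]: "\<i> *\<^sub>C \<i> *\<^sub>C x = - x"
  using scaleC_of_real[of "-1" x] by (simp add: scaleC_scaleC)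

lemma inner_scaleC_ii_left: "inner (\<i> *\<^sub>C x) y = - inner x (\<i> *\<^sub>C y)"
  using inner_scaleC_ii[of x "\<i> *\<^sub>C y"] by simp

lemma bounded_linear_scaleC_ii: "bounded_linear (\<lambda>x::'a::complex_inner. \<i> *\<^sub>C x)"
proof (rule bounded_linear_intro)
  show "\<i> *\<^sub>C (r *\<^sub>R x) = r *\<^sub>R \<i> *\<^sub>C x" for r and x :: 'a
    by (simp add: scaleC_scaleC mult.commute flip: scaleC_of_real)
  show "norm (\<i> *\<^sub>C x) \<le> norm x * 1" for x :: 'a by simp
qed (rule scaleC_add_right)

text \<open>Elements of the type are already real-linear, so complex linearity only has to be tested
  on the imaginary unit.\<close>

lemma bounded_ops_iff: "T \<in> bounded_ops \<longleftrightarrow> (\<forall>x. T (\<i> *\<^sub>C x) = \<i> *\<^sub>C T x)"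
proof
  assume "\<forall>x. T (\<i> *\<^sub>C x) = \<i> *\<^sub>C T x"
  then have "T (c *\<^sub>C x) = c *\<^sub>C T x" for c x
    by (simp add: scaleC_eq[of c] blinfun.add_right blinfun.scaleR_right)
  then show "T \<in> bounded_ops" by (simp add: bounded_ops_def)
qed (simp add: bounded_ops_def)

lemma compose_bounded_ops: "S \<in> bounded_ops \<Longrightarrow> T \<in> bounded_ops \<Longrightarrow> S o\<^sub>L T \<in> bounded_ops"
  by (simp add: bounded_ops_def)

text \<open>The real identity is enough: the imaginary part of the complex one is the same identity
  at \<open>\<i> *\<^sub>C x\<close>.\<close>

lemma op_adjoint_eqI:
  assumes "S \<in> bounded_ops" "T \<in> bounded_ops" "\<And>x y. inner (T x) y = inner x (S y)"
  shows "op_adjoint T = S"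
  unfolding op_adjoint_def
proof (rule the_equality)
  show "S \<in> bounded_ops \<and> (\<forall>x y. cinner (T x) y = cinner x (S y))"
    using assms by (auto simp: cinner_eq bounded_ops_iff simp flip: assms(3))
next
  fix S' assume "S' \<in> bounded_ops \<and> (\<forall>x y. cinner (T x) y = cinner x (S' y))"
  then have "inner x (S' y) = inner x (S y)" for x y
    by (metis Re_cinner assms(3))
  then show "S' = S" by (metis blinfun_eqI vector_eq_ldot)
qed

text \<open>This shows that the definite description in \<open>op_adjoint\<close> denotes. The
  adjoint is the operator representing the real form \<open>inner (T x) y\<close>; it is
  complex-linear because \<open>T\<close> commutes with the imaginary unit, which acts as a skew
  operator.\<close>

lemma op_adjoint:
  assumes "T \<in> bounded_ops"
  shows inner_op_adjoint: "inner (T x) y = inner x (op_adjoint T y)"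
    and norm_op_adjoint_le: "norm (op_adjoint T) \<le> norm T"
proof -
  have "bounded_bilinear (\<lambda>x. inner (T x))"
    using bounded_bilinear.comp1[OF bounded_bilinear_inner blinfun.bounded_linear_right] .
  note representation = bounded_bilinear_representation[OF this]
  then obtain S :: "'a \<Rightarrow>\<^sub>L 'a" where S: "\<And>x y. inner (T x) y = inner x (S y)"
    using representation by blast
  have "inner x (S (\<i> *\<^sub>C y)) = inner x (\<i> *\<^sub>C S y)" for x y
  proof -
    have "inner x (S (\<i> *\<^sub>C y)) = - inner (\<i> *\<^sub>C T x) y"
      by (simp add: inner_scaleC_ii_left flip: S)
    also have "\<dots> = - inner (\<i> *\<^sub>C x) (S y)"
      using assms by (simp add: bounded_ops_iff flip: S)
    finally show ?thesis by (simp add: inner_scaleC_ii_left)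
  qed
  then have "S \<in> bounded_ops" by (metis bounded_ops_iff vector_eq_ldot)
  then have *: "op_adjoint T = S" using op_adjoint_eqI assms S by blast
  show "inner (T x) y = inner x (op_adjoint T y)" by (simp add: * S)
  show "norm (op_adjoint T) \<le> norm T"
    unfolding *
  proof (rule norm_blinfun_bound)
    fix y
    have "norm (S y) * norm (S y) = inner (T (S y)) y"
      by (simp add: S flip: power2_norm_eq_inner power2_eq_square)
    also have "\<dots> \<le> norm (T (S y)) * norm y" by (rule norm_cauchy_schwarz)
    also have "\<dots> \<le> (norm T * norm (S y)) * norm y" by (intro mult_right_mono norm_blinfun) simp
    finally show "norm (S y) \<le> norm T * norm y" by (cases "S y = 0") auto
  qed simp
qed

lemma op_inverse_eqI:
  assumes "S \<in> bounded_ops" "L o\<^sub>L S = id_blinfun" "S o\<^sub>L L = id_blinfun"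
  shows "op_inverse L = S"
  unfolding op_inverse_def
proof (rule the_equality)
  fix S' assume "S' \<in> bounded_ops \<and> L o\<^sub>L S' = id_blinfun \<and> S' o\<^sub>L L = id_blinfun"
  then show "S' = S"
    using assms(3) by (metis blinfun_apply_blinfun_compose blinfun_eqI id_blinfun.rep_eq)
qed (use assms in simp)

text \<open>By polarization \<open>U\<close> preserves inner products, so writing \<open>y\<close>
  as \<open>U (V y)\<close> moves \<open>U\<close> across. It is used for a representation, where
  \<open>V\<close> is the operator at the inverse element.\<close>

lemma op_adjoint_isometry:
  fixes U :: "'a::chilbert_space \<Rightarrow>\<^sub>L 'a"
  assumes "U \<in> bounded_ops" "V \<in> bounded_ops" "U o\<^sub>L V = id_blinfun"
    and "\<And>x. norm (U x) = norm x"
  shows "op_adjoint U = V"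
proof (rule op_adjoint_eqI)
  show "inner (U x) y = inner x (V y)" for x y
  proof -
    have "U (V y) = y" using assms(3) by (metis blinfun_apply_blinfun_compose id_blinfun.rep_eq)
    then have "inner (U x) y = inner (U x) (U (V y))" by simp
    also have "\<dots> = inner x (V y)" by (simp add: dot_norm assms(4) flip: blinfun.add_right)
    finally show ?thesis .
  qed
qed fact+

text \<open>Since \<open>|R x|^2 = b x x\<close>, invariance of \<open>b\<close> on the diagonal
  already makes the conjugated operators isometries, and they are invertible because they form a
  representation. The bounds on \<open>b\<close> become \<open>|R x| \<le> C * |x|\<close> and
  \<open>|x| \<le> C * |R x|\<close>.\<close>

lemma invariant_form_imp_unitary:
  fixes \<pi> :: "'g::topological_group_add \<Rightarrow> ('h::chilbert_space \<Rightarrow>\<^sub>L 'h)" and b :: "'h \<Rightarrow> 'h \<Rightarrow> real"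
  assumes rep: "continuous_rep \<pi>"
    and bilinear: "bounded_bilinear b" and sym: "\<And>x y. b x y = b y x"
    and ii: "\<And>x y. b (\<i> *\<^sub>C x) (\<i> *\<^sub>C y) = b x y"
    and invariant: "\<And>s x. b (\<pi> s x) (\<pi> s x) = b x x"
    and C: "1 \<le> C"
    and lower: "\<And>x. (norm x)\<^sup>2 / C\<^sup>2 \<le> b x x" and upper: "\<And>x. b x x \<le> C\<^sup>2 * (norm x)\<^sup>2"
  shows "\<exists>L. invertible_op L \<and> norm (op_inverse L) * norm L \<le> C\<^sup>2 \<and> unitary_rep (conj_rep L \<pi>)"
proof -
  obtain S :: "'h \<Rightarrow>\<^sub>L 'h" where S: "\<And>x y. b x y = inner x (S y)"
    using bounded_bilinear_representation[OF bilinear] by blast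
  have S_ii: "S (\<i> *\<^sub>C x) = \<i> *\<^sub>C S x" for x
  proof -
    have "inner y (S (\<i> *\<^sub>C x)) = inner y (\<i> *\<^sub>C S x)" for y
    proof -
      \<comment> \<open>Writing \<open>y\<close> as minus its double product with the imaginary unit
        lets invariance of \<open>b\<close> strip one factor from both arguments.\<close>
      have "inner y (S (\<i> *\<^sub>C x)) = b (- (\<i> *\<^sub>C \<i> *\<^sub>C y)) (\<i> *\<^sub>C x)" by (simp add: S)
      also have "\<dots> = - b (\<i> *\<^sub>C y) x"
        by (simp only: bounded_bilinear.minus_left[OF bilinear] ii)
      finally show ?thesis by (simp add: S inner_scaleC_ii_left)
    qed
    then show ?thesis by (metis vector_eq_ldot)
  qed
  have S_sym: "inner (S x) y = inner x (S y)" for x y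
    using sym[of x y] by (simp add: S inner_commute)
  have C2: "0 < 1 / C\<^sup>2" "1 / C\<^sup>2 \<le> C\<^sup>2"
  proof -
    have "1 \<le> C\<^sup>2" using C by simp
    moreover from this have "0 < 1 / C\<^sup>2" "1 / C\<^sup>2 \<le> 1"
      by (auto simp only: zero_less_divide_1_iff divide_le_eq_1_pos intro: less_le_trans[OF zero_less_one])
    ultimately show "0 < 1 / C\<^sup>2" "1 / C\<^sup>2 \<le> C\<^sup>2" by linarith+
  qed
  obtain R :: "'h \<Rightarrow>\<^sub>L 'h" where R_sym: "\<And>x y. inner (R x) y = inner x (R y)" and R2: "R o\<^sub>L R = S" and R_surj: "surj (blinfun_apply R)"
    and R_commute: "\<And>J. J o\<^sub>L S = S o\<^sub>L J \<Longrightarrow> J o\<^sub>L R = R o\<^sub>L J"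
  proof (rule positive_sqrt[OF S_sym C2])
    show "1 / C\<^sup>2 * (norm x)\<^sup>2 \<le> inner x (S x)" "inner x (S x) \<le> C\<^sup>2 * (norm x)\<^sup>2" for x
      using lower[of x] upper[of x] by (simp_all add: S)
  qed (rule that)
  have R_bounded_ops: "R \<in> bounded_ops"
  proof -
    \<comment> \<open>Multiplication by the imaginary unit as a real operator: it commutes with
      \<open>S\<close>, so the commutant property of the square root applies to it.\<close>
    define J where "J = Blinfun (\<lambda>x::'h. \<i> *\<^sub>C x)"
    have J: "blinfun_apply J = (\<lambda>x. \<i> *\<^sub>C x)"
      unfolding J_def by (rule bounded_linear_Blinfun_apply[OF bounded_linear_scaleC_ii])
    have "J o\<^sub>L R = R o\<^sub>L J"
      by (rule R_commute, rule blinfun_eqI) (simp add: J S_ii)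
    then have "(J o\<^sub>L R) x = (R o\<^sub>L J) x" for x by simp
    then show ?thesis by (simp add: bounded_ops_iff J)
  qed
  have norm_R: "(norm (R x))\<^sup>2 = b x x" for x
    by (simp add: S power2_norm_eq_inner R_sym flip: R2)
  have norm_R_le: "norm (R x) \<le> C * norm x" for x
    using upper[of x] C by - (rule power2_le_imp_le; auto simp: norm_R power_mult_distrib)
  have norm_R_ge: "norm x \<le> C * norm (R x)" for x
    using lower[of x] C by - (rule power2_le_imp_le; auto simp: norm_R power_mult_distrib field_simps)
  \<comment> \<open>Surjectivity comes with the square root. The lower bound on \<open>b\<close>
    supplies both injectivity and, below, the bound \<open>C\<close> on the inverse.\<close>
  have "\<exists>v. \<forall>x. R (v x) = x \<and> v (R x) = x"
  proof -
    have "inj (blinfun_apply R)"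
    proof (rule injI)
      fix x y assume "R x = R y"
      then show "x = y" using norm_R_ge[of "x - y"] by (simp add: blinfun.diff_right)
    qed
    then show ?thesis using R_surj by (metis inv_f_f surj_f_inv_f)
  qed
  then obtain v where v: "\<And>x. R (v x) = x" "\<And>x. v (R x) = x" by metis
  have "bounded_linear v"
  proof (rule bounded_linear_intro)
    show "v (x + y) = v x + v y" for x y by (metis v blinfun.add_right)
    show "v (r *\<^sub>R x) = r *\<^sub>R v x" for r x by (metis v blinfun.scaleR_right)
    show "norm (v x) \<le> norm x * C" for x using norm_R_ge[of "v x"] by (simp add: v mult.commute)
  qed
  define L where "L = Blinfun v"
  have L: "blinfun_apply L = v"
    unfolding L_def by (rule bounded_linear_Blinfun_apply) fact
  have RL: "R o\<^sub>L L = id_blinfun" and LR: "L o\<^sub>L R = id_blinfun"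
    by (auto intro!: blinfun_eqI simp: L v)
  have L_bounded_ops: "L \<in> bounded_ops"
    using R_bounded_ops unfolding bounded_ops_iff L by (metis v)
  have inverse: "op_inverse L = R"
    by (rule op_inverse_eqI[OF R_bounded_ops LR RL])
  have "norm R \<le> C" "norm L \<le> C"
    using C norm_R_le norm_R_ge[of "v _"] by (auto intro!: norm_blinfun_bound simp: L v)
  then have "norm (op_inverse L) * norm L \<le> C\<^sup>2"
    using C by (simp add: inverse power2_eq_square mult_mono)
  moreover have "invertible_op L"
    using L_bounded_ops R_bounded_ops LR RL by (auto simp: invertible_op_def)
  moreover have "unitary_rep (conj_rep L \<pi>)"
  proof -
    define \<rho> where "\<rho> = conj_rep L \<pi>"
    have \<rho>: "\<rho> g x = R (\<pi> g (v x))" for g x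
      by (simp add: \<rho>_def conj_rep_def inverse L)
    have \<pi>: "\<And>g. \<pi> g \<in> bounded_ops" "\<pi> 0 = id_blinfun" "\<And>g h x. \<pi> (g + h) x = \<pi> g (\<pi> h x)"
      "\<And>x. continuous_on UNIV (\<lambda>g. \<pi> g x)"
      using rep by (auto simp: continuous_rep_def)
    have \<rho>_bounded_ops: "\<rho> g \<in> bounded_ops" for g
      unfolding \<rho>_def conj_rep_def inverse
      by (intro compose_bounded_ops R_bounded_ops L_bounded_ops \<pi>)
    have \<rho>_add: "\<rho> (g + h) = \<rho> g o\<^sub>L \<rho> h" for g h
      by (rule blinfun_eqI) (simp add: \<rho> v \<pi>)
    have \<rho>_0: "\<rho> 0 = id_blinfun"
      by (rule blinfun_eqI) (simp add: \<rho> v \<pi>)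
    have "continuous_on UNIV (\<lambda>g. \<rho> g x)" for x
      unfolding \<rho> by (intro blinfun.continuous_on continuous_on_const \<pi>)
    with \<rho>_bounded_ops \<rho>_add \<rho>_0 have "continuous_rep \<rho>" by (simp add: continuous_rep_def)
    moreover have inv: "\<rho> g o\<^sub>L \<rho> (- g) = id_blinfun" "\<rho> (- g) o\<^sub>L \<rho> g = id_blinfun" for g
      using \<rho>_add[of g "- g"] \<rho>_add[of "- g" g] \<rho>_0 by auto
    moreover have "op_adjoint (\<rho> g) = \<rho> (- g)" for g
    proof (rule op_adjoint_isometry[OF \<rho>_bounded_ops \<rho>_bounded_ops inv(1)])
      fix x
      have "(norm (\<rho> g x))\<^sup>2 = (norm (R (v x)))\<^sup>2"
        by (simp only: \<rho> norm_R invariant)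
      then show "norm (\<rho> g x) = norm x" by (simp add: v)
    qed
    ultimately show ?thesis by (simp add: unitary_rep_def flip: \<rho>_def)
  qed
  ultimately show ?thesis by blast
qed

section \<open>Inversion invariance of Haar measure\<close>

text \<open>By compactness of \<open>L\<close>, near each \<open>x\<close> the kernel is uniformly
  close on \<open>L\<close> to its section at \<open>x\<close>. That section depends on the second
  coordinate alone and is therefore measurable on the product. Finitely many such neighbourhoods
  cover \<open>K\<close>.\<close>

lemma continuous_kernel_approx:
  fixes k :: "'a::t2_space \<times> 'b::topological_space \<Rightarrow> real"
  assumes k: "continuous_on UNIV k" and "compact K" "compact L" "0 < e"
  obtains h where "h \<in> borel_measurable (borel \<Otimes>\<^sub>M borel)"
    and "\<And>z. z \<in> K \<times> L \<Longrightarrow> \<bar>h z - k z\<bar> \<le> e"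
proof -
  \<comment> \<open>Requiring \<open>S\<close> to be Borel allows two approximants to be glued by a
    case distinction on the first coordinate.\<close>
  define P where "P S \<longleftrightarrow> S \<in> sets borel \<and>
    (\<exists>h \<in> borel_measurable (borel \<Otimes>\<^sub>M borel). \<forall>z \<in> S \<times> L. \<bar>h z - k z\<bar> \<le> e)" for S
  have P_local: "\<exists>U. open U \<and> x \<in> U \<and> P U" for x
  proof -
    have "continuous_on (UNIV \<times> L) k" using k continuous_on_subset by blast
    then obtain U where U: "x \<in> U" "open U" "\<forall>x'\<in>U \<inter> UNIV. \<forall>y\<in>L. dist (k (x', y)) (k (x, y)) \<le> e"
      using continuous_on_prod_compactE[OF _ \<open>compact L\<close> UNIV_I \<open>0 < e\<close>] by metis
    have "(\<lambda>y. k (x, y)) \<in> borel_measurable borel"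
      by (intro borel_measurable_continuous_onI continuous_on_compose2[OF k] continuous_intros) auto
    then have "(\<lambda>z :: 'a \<times> 'b. k (x, snd z)) \<in> borel_measurable (borel \<Otimes>\<^sub>M borel)"
      by measurable
    moreover have "\<forall>z \<in> U \<times> L. \<bar>k (x, snd z) - k z\<bar> \<le> e"
      using U by (auto simp: dist_real_def abs_minus_commute)
    moreover have "U \<in> sets borel" using U by simp
    ultimately have "P U" unfolding P_def by (intro conjI bexI[of _ "\<lambda>z. k (x, snd z)"])
    then show ?thesis using U by blast
  qed
  have P_Un: "P (S \<union> T)" if S: "P S" and T: "P T" for S T
  proof -
    obtain h h' where [measurable]: "h \<in> borel_measurable (borel \<Otimes>\<^sub>M borel)"
      "h' \<in> borel_measurable (borel \<Otimes>\<^sub>M borel)" "S \<in> sets borel" "T \<in> sets borel"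
      and h: "\<forall>z \<in> S \<times> L. \<bar>h z - k z\<bar> \<le> e" "\<forall>z \<in> T \<times> L. \<bar>h' z - k z\<bar> \<le> e"
      using S T unfolding P_def by blast
    have "(\<lambda>z. if fst z \<in> S then h z else h' z) \<in> borel_measurable (borel \<Otimes>\<^sub>M borel)"
      by measurable
    moreover have "\<forall>z \<in> (S \<union> T) \<times> L. \<bar>(if fst z \<in> S then h z else h' z) - k z\<bar> \<le> e"
      using h by auto
    moreover have "S \<union> T \<in> sets borel" by measurable
    ultimately show ?thesis
      unfolding P_def by (intro conjI bexI[of _ "\<lambda>z. if fst z \<in> S then h z else h' z"])
  qed
  have P_Union: "P (\<Union>\<U>)" if "finite \<U>" "\<forall>U\<in>\<U>. P U" for \<U>
    using that
  proof (induction \<U> rule: finite_induct)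
    case empty
    have "(\<lambda>_ :: 'a \<times> 'b. 0 :: real) \<in> borel_measurable (borel \<Otimes>\<^sub>M borel)" by simp
    then show ?case unfolding P_def by blast
  qed (simp add: P_Un)
  have "K \<subseteq> \<Union>{U. open U \<and> P U}" using P_local by blast
  then obtain \<U> where "\<U> \<subseteq> {U. open U \<and> P U}" "finite \<U>" "K \<subseteq> \<Union>\<U>"
    using compactE[OF \<open>compact K\<close>] by (metis (no_types, lifting) mem_Collect_eq)
  with P_Union[of \<U>] show thesis by (fastforce simp: P_def intro: that)
qed

text \<open>The Borel sets of a product need not be generated by rectangles without a countable base, so
  this is not an instance of measurability of continuous functions.\<close>

lemma borel_measurable_continuous_pair:
  fixes k :: "'a::t2_space \<times> 'a \<Rightarrow> real"
  assumes "sigma_compact (UNIV :: 'a set)" and k: "continuous_on UNIV k"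
  shows "k \<in> borel_measurable (borel \<Otimes>\<^sub>M borel)"
proof -
  obtain K :: "nat \<Rightarrow> 'a set" where K: "\<And>n. compact (K n)" "(\<Union>n. K n) = UNIV"
    using assms by (auto simp: sigma_compact_def)
  \<comment> \<open>Increasing compact sets: every point of the product lies in
    \<open>L n \<times> L n\<close> for all large \<open>n\<close>, so the approximants converge
    everywhere.\<close>
  define L where "L n = (\<Union>i\<le>n. K i)" for n
  have L: "compact (L n)" for n using K by (auto simp: L_def)
  have "\<exists>h. h \<in> borel_measurable (borel \<Otimes>\<^sub>M borel) \<and>
      (\<forall>z \<in> L n \<times> L n. \<bar>h z - k z\<bar> \<le> 1 / Suc n)" for n
    using continuous_kernel_approx[OF k L L, of "1 / Suc n" n n] by (metis of_nat_0_less_iff zero_less_Suc zero_less_divide_1_iff)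
  then obtain h where h: "\<And>n. h n \<in> borel_measurable (borel \<Otimes>\<^sub>M borel)"
    "\<And>n z. z \<in> L n \<times> L n \<Longrightarrow> \<bar>h n z - k z\<bar> \<le> 1 / Suc n" by metis
  show ?thesis
  proof (rule borel_measurable_LIMSEQ_real)
    fix z
    obtain i j where "fst z \<in> K i" "snd z \<in> K j" using K(2) by (metis UNIV_I UN_E)
    then have "\<bar>h n z - k z\<bar> \<le> 1 / Suc n" if "max i j \<le> n" for n
      using that by (intro h) (force simp: L_def mem_Times_iff)
    then have "\<forall>\<^sub>F n in sequentially. norm (h n z - k z) \<le> 1 / Suc n"
      unfolding eventually_sequentially real_norm_def by blast
    moreover have "(\<lambda>n. 1 / real (Suc n)) \<longlonglongrightarrow> 0" by (rule LIMSEQ_Suc[OF lim_1_over_n])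
    ultimately have "(\<lambda>n. h n z - k z) \<longlonglongrightarrow> 0" by (rule Lim_null_comparison)
    then show "(\<lambda>n. h n z) \<longlonglongrightarrow> k z" by (rule Lim_null[THEN iffD2])
  qed (rule h)
qed

section \<open>Bump functions on locally compact Hausdorff spaces\<close>

lemma Hausdorff_space_euclidean_t2: "Hausdorff_space (euclidean :: 'a::t2_space topology)"
  unfolding Hausdorff_space_def by (metis disjnt_def hausdorff open_openin)

lemma compact_neighbourhood:
  fixes K :: "'a::t2_space set"
  assumes "locally_compact_space (euclidean :: 'a topology)" "compact K"
  obtains V L where "open V" "compact L" "K \<subseteq> V" "V \<subseteq> L"
proof -
  have "Hausdorff_space (euclidean :: 'a topology) \<or> regular_space (euclidean :: 'a topology)"
    using Hausdorff_space_euclidean_t2 by (rule disjI1)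
  note iff = locally_compact_space_compact_closed_compact[OF this]
  have "\<exists>V L. openin euclidean V \<and> compactin euclidean L \<and> closedin euclidean L \<and> K \<subseteq> V \<and> V \<subseteq> L"
    using assms(1)[unfolded iff, rule_format, of K] assms(2) by simp
  then obtain V L where "openin euclidean V" "compactin euclidean L" "K \<subseteq> V" "V \<subseteq> L"
    by blast
  then show thesis by (intro that[of V L]) simp_all
qed

text \<open>Locally compact Hausdorff spaces are completely regular, which separates a compact set
  from a disjoint closed one. Only the upper bound on \<open>f\<close> is recorded, because the
  later integrals apply \<open>ennreal\<close>, which sends negative values to 0.\<close>

lemma continuous_bump:
  fixes K V :: "'a::t2_space set"
  assumes "locally_compact_space (euclidean :: 'a topology)" "compact K" "open V" "K \<subseteq> V"
  obtains f :: "'a \<Rightarrow> real" where "continuous_on UNIV f" "\<forall>x. f x \<le> 1"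
    "\<forall>x\<in>K. f x = 1" "\<forall>x. x \<notin> V \<longrightarrow> f x = 0"
proof -
  have "completely_regular_space (euclidean :: 'a topology)"
    by (rule locally_compact_regular_imp_completely_regular_space)
      (use assms Hausdorff_space_euclidean_t2 in auto)
  moreover have "compactin euclidean K" "closedin euclidean (- V)" "disjnt K (- V)"
    using assms by (auto simp: disjnt_def)
  ultimately obtain f :: "'a \<Rightarrow> real" where f: "continuous_map euclidean (top_of_set {0..1}) f"
    "f ` (- V) \<subseteq> {0}" "f ` K \<subseteq> {1}"
    by (rule Urysohn_completely_regular_compact_closed[OF zero_le_one])
  have "continuous_on UNIV f" "\<forall>x. f x \<le> 1"
    using f(1) unfolding continuous_map_in_subtopology by (simp_all add: Pi_iff)
  moreover have "\<forall>x\<in>K. f x = 1" "\<forall>x. x \<notin> V \<longrightarrow> f x = 0" using f(2,3) by auto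
  ultimately show thesis by (rule that)
qed

lemma compact_uminus:
  fixes K :: "'a::topological_group_add set"
  shows "compact K \<Longrightarrow> compact (uminus ` K)"
  by (rule compact_continuous_image[OF continuous_on_minus[OF continuous_on_id]])

lemma translate_measurable [measurable]:
  "(\<lambda>x::'a::topological_group_add. x + s) \<in> borel_measurable borel" "(\<lambda>x::'a. s + x) \<in> borel_measurable borel"
  "uminus \<in> borel_measurable (borel :: 'a measure)"
  by (intro borel_measurable_continuous_onI continuous_intros)+

section \<open>Haar measure under translation and inversion\<close>

context
  fixes m :: "'g::{topological_group_add, t2_space} measure"
  assumes haar: "right_haar_measure m"
begin

lemma sets_haar [measurable_cong]: "sets m = sets borel"
  using haar by (simp add: right_haar_measure_def radon_measure_def)

lemma space_haar [simp]: "space m = UNIV"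
  using sets_eq_imp_space_eq[OF sets_haar] by simp

lemma emeasure_compact: "compact K \<Longrightarrow> emeasure m K < \<infinity>"
  using haar by (simp add: right_haar_measure_def radon_measure_def)

lemma emeasure_right_translate: "A \<in> sets borel \<Longrightarrow> emeasure m ((\<lambda>a. a + s) ` A) = emeasure m A"
  using haar by (simp add: right_haar_measure_def)

lemma distr_right_translate: "distr m m (\<lambda>x. x + s) = m"
proof (rule measure_eqI)
  fix A assume "A \<in> sets (distr m m (\<lambda>x. x + s))"
  then have [measurable]: "A \<in> sets borel" by (simp add: sets_haar)
  have "(\<lambda>x. x + s) -` A = (\<lambda>a. a + (- s)) ` A"
    by (auto simp: image_iff add.assoc intro!: bexI[of _ "_ + s"])
  then show "emeasure (distr m m (\<lambda>x. x + s)) A = emeasure m A"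
    using emeasure_right_translate[of A "- s"] by (subst emeasure_distr) auto
qed simp

lemma distr_left_translate:
  assumes "unimodular m"
  shows "distr m m (\<lambda>x. s + x) = m"
proof (rule measure_eqI)
  fix A assume "A \<in> sets (distr m m (\<lambda>x. s + x))"
  then have [measurable]: "A \<in> sets borel" by (simp add: sets_haar)
  have "(\<lambda>x. s + x) -` A = (\<lambda>a. (- s) + a) ` A"
    by (auto simp: image_iff intro!: bexI[of _ "s + _"] simp flip: add.assoc)
  then show "emeasure (distr m m (\<lambda>x. s + x)) A = emeasure m A"
    using assms by (subst emeasure_distr) (auto simp: unimodular_def)
qed simp

lemma sigma_finite_haar:
  assumes "sigma_compact (UNIV :: 'g set)"
  shows "sigma_finite_measure m"
proof
  obtain K :: "nat \<Rightarrow> 'g set" where K: "\<And>n. compact (K n)" "(\<Union>n. K n) = UNIV"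
    using assms by (auto simp: sigma_compact_def)
  show "\<exists>A. countable A \<and> A \<subseteq> sets m \<and> \<Union> A = space m \<and> (\<forall>a\<in>A. emeasure m a \<noteq> \<infinity>)"
  proof (intro exI[of _ "range K"] conjI)
    show "range K \<subseteq> sets m" using K by (auto simp: sets_haar intro: borel_closed compact_imp_closed)
    show "\<forall>a\<in>range K. emeasure m a \<noteq> \<infinity>"
      using emeasure_compact[OF K(1)] by (metis imageE less_irrefl)
  qed (use K in auto)
qed

lemma nn_integral_right_translate:
  assumes "u \<in> borel_measurable borel"
  shows "(\<integral>\<^sup>+x. u (x + s) \<partial>m) = (\<integral>\<^sup>+x. u x \<partial>m)"
proof -
  have "(\<integral>\<^sup>+x. u x \<partial>m) = (\<integral>\<^sup>+x. u x \<partial>distr m m (\<lambda>x. x + s))"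
    by (simp add: distr_right_translate)
  also have "\<dots> = (\<integral>\<^sup>+x. u (x + s) \<partial>m)"
    using assms by (intro nn_integral_distr) simp_all
  finally show ?thesis ..
qed

lemma nn_integral_left_translate:
  assumes "unimodular m" "u \<in> borel_measurable borel"
  shows "(\<integral>\<^sup>+x. u (s + x) \<partial>m) = (\<integral>\<^sup>+x. u x \<partial>m)"
proof -
  have "(\<integral>\<^sup>+x. u x \<partial>m) = (\<integral>\<^sup>+x. u x \<partial>distr m m (\<lambda>x. s + x))"
    by (simp add: distr_left_translate assms)
  also have "\<dots> = (\<integral>\<^sup>+x. u (s + x) \<partial>m)"
    using assms by (intro nn_integral_distr) simp_all
  finally show ?thesis ..
qed

text \<open>Three translations, separated by exchanges of the order of integration, turn
  \<open>f x * h (- y)\<close> into \<open>f x * h (- x - y)\<close>, then \<open>f (- y + x) * h (- x)\<close>, then \<open>f (- y) * h (- x)\<close>.\<close>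

lemma nn_integral_inversion_product:
  fixes f h :: "'g \<Rightarrow> real"
  assumes sc: "sigma_compact (UNIV :: 'g set)" and "unimodular m"
    and f: "continuous_on UNIV f" and h: "continuous_on UNIV h"
  shows "(\<integral>\<^sup>+x. f x \<partial>m) * (\<integral>\<^sup>+y. h (- y) \<partial>m) = (\<integral>\<^sup>+y. f (- y) \<partial>m) * (\<integral>\<^sup>+x. h (- x) \<partial>m)"
proof -
  interpret sigma_finite_measure m by (rule sigma_finite_haar[OF sc])
  interpret pair_sigma_finite m m ..
  have [measurable]: "f \<in> borel_measurable borel" "h \<in> borel_measurable borel"
    using f h by (auto intro: borel_measurable_continuous_onI)
  \<comment> \<open>These kernels mix the two coordinates, and Fubini asks for measurability with
    respect to the product of the Borel sigma-algebras.\<close>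
  have [measurable]: "(\<lambda>z. h (- fst z - snd z)) \<in> borel_measurable (borel \<Otimes>\<^sub>M borel)"
    "(\<lambda>z. f (- snd z + fst z)) \<in> borel_measurable (borel \<Otimes>\<^sub>M borel)"
    unfolding diff_conv_add_uminus
    by (intro borel_measurable_continuous_pair[OF sc] continuous_on_compose2[OF h]
        continuous_on_compose2[OF f] continuous_intros; simp)+
  have [measurable]: "(\<lambda>y. h (- x - y)) \<in> borel_measurable borel" "(\<lambda>x. h (- x - y)) \<in> borel_measurable borel"
    "(\<lambda>y. f (- y + x)) \<in> borel_measurable borel" "(\<lambda>x. f (- y + x)) \<in> borel_measurable borel" for x y
    unfolding diff_conv_add_uminus
    by (intro borel_measurable_continuous_onI continuous_on_compose2[OF h]
        continuous_on_compose2[OF f] continuous_intros; simp)+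
  have "(\<integral>\<^sup>+x. f x \<partial>m) * (\<integral>\<^sup>+y. h (- y) \<partial>m) = (\<integral>\<^sup>+x. f x * (\<integral>\<^sup>+y. h (- y) \<partial>m) \<partial>m)"
    by (rule nn_integral_multc[symmetric]) simp
  also have "\<dots> = (\<integral>\<^sup>+x. f x * (\<integral>\<^sup>+y. h (- (y + x)) \<partial>m) \<partial>m)"
    by (subst nn_integral_right_translate[of "\<lambda>y. h (- y)"]) simp_all
  also have "\<dots> = (\<integral>\<^sup>+x. (\<integral>\<^sup>+y. f x * ennreal (h (- x - y)) \<partial>m) \<partial>m)"
    by (subst nn_integral_cmult) (simp_all add: minus_add)
  also have "\<dots> = (\<integral>\<^sup>+y. (\<integral>\<^sup>+x. f x * ennreal (h (- x - y)) \<partial>m) \<partial>m)"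
    by (rule Fubini'[symmetric]) (simp add: split_beta')
  also have "\<dots> = (\<integral>\<^sup>+y. (\<integral>\<^sup>+x. f (- y + x) * ennreal (h (- (- y + x) - y)) \<partial>m) \<partial>m)"
    by (subst nn_integral_left_translate[OF \<open>unimodular m\<close>, of "\<lambda>x. f x * ennreal (h (- x - _))"]) simp_all
  also have "\<dots> = (\<integral>\<^sup>+y. (\<integral>\<^sup>+x. f (- y + x) * ennreal (h (- x)) \<partial>m) \<partial>m)"
    by (simp add: minus_add)
  also have "\<dots> = (\<integral>\<^sup>+x. (\<integral>\<^sup>+y. f (- y + x) * ennreal (h (- x)) \<partial>m) \<partial>m)"
    by (rule Fubini') (simp add: split_beta')
  also have "\<dots> = (\<integral>\<^sup>+x. (\<integral>\<^sup>+y. f (- y + x) \<partial>m) * ennreal (h (- x)) \<partial>m)"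
    by (subst nn_integral_multc) simp_all
  also have "\<dots> = (\<integral>\<^sup>+x. (\<integral>\<^sup>+y. f (- (x + y) + x) \<partial>m) * ennreal (h (- x)) \<partial>m)"
    by (subst nn_integral_left_translate[OF \<open>unimodular m\<close>, of "\<lambda>y. f (- y + _)"]) simp_all
  also have "\<dots> = (\<integral>\<^sup>+x. (\<integral>\<^sup>+y. f (- y) \<partial>m) * ennreal (h (- x)) \<partial>m)"
    by (simp add: minus_add add.assoc)
  also have "\<dots> = (\<integral>\<^sup>+y. f (- y) \<partial>m) * (\<integral>\<^sup>+x. h (- x) \<partial>m)"
    by (rule nn_integral_cmult) simp
  finally show ?thesis .
qed

text \<open>In the product identity the factor coming from \<open>h\<close> can be cancelled once it
  is neither 0 nor infinite, so \<open>f\<close> and its reflection have equal integrals. A bump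
  \<open>f\<close> between the indicators of \<open>K\<close> and \<open>U\<close>, followed by
  inner regularity, gives the claim.\<close>

lemma emeasure_open_le_uminus:
  assumes sc: "sigma_compact (UNIV :: 'g set)" and lc: "locally_compact_space (euclidean :: 'g topology)"
    and "unimodular m" and "compact B" "0 < emeasure m B" and "open U"
  shows "emeasure m U \<le> emeasure m (uminus ` U)"
proof -
  have compact_B: "compact (uminus ` B)"
    by (rule compact_uminus) fact
  \<comment> \<open>The bump \<open>h\<close> is 1 on the reflection of \<open>B\<close>, which
    makes the integral of \<open>h (- x)\<close> positive, and it vanishes off a subset of the
    compact \<open>L\<close>, which makes that integral finite.\<close>
  obtain V L where V: "open V" "compact L" "uminus ` B \<subseteq> V" "V \<subseteq> L"
    using compact_neighbourhood[OF lc compact_B] .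
  obtain h :: "'g \<Rightarrow> real" where h: "continuous_on UNIV h" "\<forall>x. h x \<le> 1"
    "\<forall>x\<in>uminus ` B. h x = 1" "\<forall>x. x \<notin> V \<longrightarrow> h x = 0"
    using continuous_bump[OF lc compact_B V(1,3)] .
  have B [measurable]: "B \<in> sets borel" and L [measurable]: "uminus ` L \<in> sets borel"
    using \<open>compact B\<close> V by (auto intro!: borel_closed compact_imp_closed compact_uminus)
  have h_pos: "(\<integral>\<^sup>+x. h (- x) \<partial>m) \<noteq> 0"
  proof -
    have "emeasure m B = (\<integral>\<^sup>+x. indicator B x \<partial>m)" by simp
    also have "\<dots> \<le> (\<integral>\<^sup>+x. h (- x) \<partial>m)"
      using h(3) by (intro nn_integral_mono) (auto simp: indicator_def)
    finally show ?thesis using \<open>0 < emeasure m B\<close> by auto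
  qed
  have h_fin: "(\<integral>\<^sup>+x. h (- x) \<partial>m) \<noteq> top"
  proof -
    have "(\<integral>\<^sup>+x. h (- x) \<partial>m) \<le> (\<integral>\<^sup>+x. indicator (uminus ` L) x \<partial>m)"
    proof (rule nn_integral_mono)
      fix x
      have "h (- x) \<le> 1" using h(2) by blast
      moreover have "h (- x) = 0" if "x \<notin> uminus ` L"
      proof -
        have "- x \<notin> L" using that by (metis image_eqI minus_minus)
        then show ?thesis using h V by blast
      qed
      ultimately show "ennreal (h (- x)) \<le> indicator (uminus ` L) x" by (auto simp: indicator_def)
    qed
    also have "\<dots> = emeasure m (uminus ` L)" by simp
    also have "\<dots> < \<infinity>" using V by (intro emeasure_compact compact_uminus)
    finally show ?thesis by auto
  qed
  have open_uminus: "open (uminus ` U)"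
  proof -
    have "uminus ` U = uminus -` U" by (auto intro: rev_image_eqI)
    moreover have "open (uminus -` U)" using \<open>open U\<close> by (intro open_vimage continuous_intros)
    ultimately show ?thesis by simp
  qed
  have "emeasure m K \<le> emeasure m (uminus ` U)" if K: "compact K" "K \<subseteq> U" for K
  proof -
    obtain f :: "'g \<Rightarrow> real" where f: "continuous_on UNIV f" "\<forall>x. f x \<le> 1"
      "\<forall>x\<in>K. f x = 1" "\<forall>x. x \<notin> U \<longrightarrow> f x = 0"
      using continuous_bump[OF lc K(1) \<open>open U\<close> K(2)] .
    have [measurable]: "K \<in> sets borel" "uminus ` U \<in> sets borel"
      using K open_uminus by (auto intro: borel_closed compact_imp_closed)
    have "emeasure m K = (\<integral>\<^sup>+x. indicator K x \<partial>m)" by simp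
    also have "\<dots> \<le> (\<integral>\<^sup>+x. f x \<partial>m)"
      using f(3) by (intro nn_integral_mono) (auto simp: indicator_def)
    also have "\<dots> = (\<integral>\<^sup>+x. f (- x) \<partial>m)"
      using nn_integral_inversion_product[OF sc \<open>unimodular m\<close> f(1) h(1)] h_pos h_fin
      by (metis ennreal_mult_divide_eq)
    also have "\<dots> \<le> (\<integral>\<^sup>+x. indicator (uminus ` U) x \<partial>m)"
    proof (rule nn_integral_mono)
      fix x
      have "f (- x) \<le> 1" using f(2) by blast
      moreover have "f (- x) = 0" if "x \<notin> uminus ` U"
        using that f by (metis image_eqI minus_minus)
      ultimately show "ennreal (f (- x)) \<le> indicator (uminus ` U) x" by (auto simp: indicator_def)
    qed
    also have "\<dots> = emeasure m (uminus ` U)" by simp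
    finally show ?thesis .
  qed
  moreover have "emeasure m U = (SUP K\<in>{K. compact K \<and> K \<subseteq> U}. emeasure m K)"
    using haar \<open>open U\<close> unfolding right_haar_measure_def radon_measure_def by blast
  ultimately show ?thesis by (auto intro: SUP_least)
qed

text \<open>Outer regularity extends the inequality from open to Borel sets. Inversion is an
  involution, so the inequality for \<open>A\<close> and for its reflection together give
  equality.\<close>

lemma distr_uminus:
  assumes "sigma_compact (UNIV :: 'g set)" "locally_compact_space (euclidean :: 'g topology)"
    and "unimodular m" "compact B" "0 < emeasure m B"
  shows "distr m m uminus = m"
proof (rule measure_eqI)
  have vimage: "uminus -` A = uminus ` A" for A :: "'g set"
    by (auto intro: rev_image_eqI)
  have le: "emeasure m (uminus ` A) \<le> emeasure m A" if A: "A \<in> sets borel" for A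
  proof -
    have "emeasure m (uminus ` A) \<le> emeasure m U" if U: "open U" "A \<subseteq> U" for U
    proof -
      have U': "open (uminus ` U)"
        unfolding vimage[symmetric] using U by (intro open_vimage continuous_intros)
      have "emeasure m (uminus ` A) \<le> emeasure m (uminus ` U)"
        using U U' by (intro emeasure_mono) (auto simp: sets_haar)
      also have "\<dots> \<le> emeasure m (uminus ` uminus ` U)"
        by (rule emeasure_open_le_uminus[OF assms U'])
      finally show ?thesis by (simp add: image_image)
    qed
    moreover have "emeasure m A = (INF U\<in>{U. open U \<and> A \<subseteq> U}. emeasure m U)"
      using haar A unfolding right_haar_measure_def radon_measure_def by blast
    ultimately show ?thesis by (auto intro: INF_greatest)
  qed
  fix A assume "A \<in> sets (distr m m uminus)"
  then have A [measurable]: "A \<in> sets borel" by (simp add: sets_haar)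
  have "uminus ` A \<in> sets borel"
    unfolding vimage[symmetric] using measurable_sets[OF translate_measurable(3)[where ?'a = 'g] A] by simp
  then have "emeasure m A \<le> emeasure m (uminus ` A)" using le[of "uminus ` A"] by (simp add: image_image)
  with le[OF A] show "emeasure (distr m m uminus) A = emeasure m A"
    by (subst emeasure_distr) (auto simp: vimage)
qed simp

end

section \<open>Averages of a representation\<close>

text \<open>By Baire, one of the closed sets \<open>E n\<close> of vectors with orbit bounded by
  \<open>n\<close> contains a ball. It serves to bound \<open>norm (\<pi> g)\<close> for
  \<open>g\<close> in a compact set.\<close>

lemma uniform_boundedness:
  fixes T :: "'i \<Rightarrow> 'a::banach \<Rightarrow>\<^sub>L 'b::real_normed_vector"
  assumes "\<And>x. \<exists>c. \<forall>i\<in>I. norm (T i x) \<le> c"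
  shows "\<exists>c. \<forall>i\<in>I. norm (T i) \<le> c"
proof -
  define E where "E n = {x. \<forall>i\<in>I. norm (T i x) \<le> real n}" for n
  have closed: "closed (E n)" for n
    unfolding E_def Ball_def
    by (intro closed_Collect_all closed_Collect_imp open_Collect_const closed_Collect_le continuous_intros)
  have "(\<Union>n. E n) = UNIV"
  proof -
    have "x \<in> (\<Union>n. E n)" for x
    proof -
      obtain c where "\<forall>i\<in>I. norm (T i x) \<le> c" using assms by blast
      moreover obtain n :: nat where "c \<le> n" using real_arch_simple by blast
      ultimately have "x \<in> E n" by (auto simp: E_def intro: order_trans)
      then show ?thesis by blast
    qed
    then show ?thesis by blast
  qed
  then have "interior (\<Union>(range E)) \<noteq> {}" by simp
  then have "\<exists>n. interior (E n) \<noteq> {}"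
    using Baire_category_alt[of "euclidean :: 'a topology" "range E"] closed
      completely_metrizable_space_euclidean[where ?'a = 'a] by fastforce
  then obtain n x e where "0 < e" and ball: "cball x e \<subseteq> E n"
    by (metis all_not_in_conv mem_interior_cball)
  have "norm (T i) \<le> 2 * real n / e" if "i \<in> I" for i
  proof (rule norm_blinfun_bound)
    fix y
    show "norm (T i y) \<le> 2 * real n / e * norm y"
    proof (cases "y = 0")
      case False
      \<comment> \<open>Both \<open>x\<close> and \<open>x + z\<close> lie in the ball, so their
        images differ by at most \<open>2 * n\<close>; rescaling from length \<open>e\<close> yields
        the constant \<open>2 * n / e\<close>.\<close>
      define z where "z = (e / norm y) *\<^sub>R y"
      have "x + z \<in> cball x e" "x \<in> cball x e"
        using False \<open>0 < e\<close> by (auto simp: z_def dist_norm)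
      then have "norm (T i (x + z)) \<le> n" "norm (T i x) \<le> n"
        using ball that unfolding E_def by blast+
      then have "norm (T i z) \<le> 2 * n"
        using norm_triangle_ineq4[of "T i (x + z)" "T i x"] by (simp add: blinfun.add_right)
      then show ?thesis
        using False \<open>0 < e\<close> by (simp add: z_def blinfun.scaleR_right field_simps)
    qed simp
  qed (use \<open>0 < e\<close> in simp)
  then show ?thesis by blast
qed

text \<open>The functions lie in a product of compact intervals, compact by Tychonoff. A filter
  replaces a convergent subsequence, which may fail to exist over an uncountable index set.\<close>

lemma pointwise_cluster_point:
  fixes f :: "nat \<Rightarrow> 'a \<Rightarrow> real"
  assumes bound: "\<And>n x. n \<ge> 1 \<Longrightarrow> \<bar>f n x\<bar> \<le> B x"
  obtains G l where "G \<le> sequentially" "G \<noteq> bot" "\<And>x. ((\<lambda>n. f n x) \<longlongrightarrow> l x) G"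
proof -
  define K where "K = Pi\<^sub>E UNIV (\<lambda>x. {- B x..B x})"
  have "compactin (product_topology (\<lambda>_. euclidean) UNIV) K"
    unfolding K_def by (simp add: compactin_PiE)
  then have "compact K" by (simp add: euclidean_product_topology)
  moreover have "eventually (\<lambda>g. g \<in> K) (filtermap f sequentially)"
    unfolding eventually_filtermap
    by (rule eventually_sequentiallyI[of 1]) (use bound in \<open>force simp: K_def abs_le_iff\<close>)
  moreover have "filtermap f sequentially \<noteq> bot" by (simp add: filtermap_bot_iff)
  ultimately obtain l where l: "inf (nhds l) (filtermap f sequentially) \<noteq> bot"
    unfolding compact_filter by blast
  \<comment> \<open>\<open>G\<close> is generated by the tails and the preimages of neighbourhoods
    of \<open>l\<close>. That \<open>l\<close> is a cluster point says exactly that these sets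
    always meet.\<close>
  define G where "G = inf (filtercomap f (nhds l)) sequentially"
  have "G \<noteq> bot"
  proof
    assume "G = bot"
    then have "eventually (\<lambda>_. False) G" by simp
    then obtain P Q where PQ: "eventually P (filtercomap f (nhds l))" "eventually Q sequentially"
      "\<And>n. P n \<Longrightarrow> Q n \<Longrightarrow> False"
      unfolding G_def eventually_inf by blast
    then obtain R where R: "eventually R (nhds l)" "\<And>n. R (f n) \<Longrightarrow> P n"
      unfolding eventually_filtercomap by blast
    have "eventually (\<lambda>g. \<not> R g) (filtermap f sequentially)"
      unfolding eventually_filtermap using PQ(2) by eventually_elim (use PQ R in blast)
    with R(1) have "eventually (\<lambda>_. False) (inf (nhds l) (filtermap f sequentially))"
      unfolding eventually_inf by blast
    with l show False by (simp add: eventually_False)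
  qed
  moreover have "((\<lambda>n. f n x) \<longlongrightarrow> l x) G" for x
  proof -
    have "(f \<longlongrightarrow> l) G"
      unfolding G_def by (intro filterlim_mono[OF filterlim_filtercomap]) auto
    then show ?thesis
      using continuous_on_tendsto_compose[OF continuous_on_product_coordinates[of x], of f l G] by simp
  qed
  moreover have "G \<le> sequentially" by (simp add: G_def)
  ultimately show thesis using that by blast
qed

text \<open>Strong continuity makes the operator norm lower semicontinuous: a sublevel set is an
  intersection of closed sets over all vectors, hence closed however many vectors there are.\<close>

lemma norm_rep_measurable:
  fixes \<pi> :: "'g::topological_group_add \<Rightarrow> ('h::chilbert_space \<Rightarrow>\<^sub>L 'h)"
  assumes "continuous_rep \<pi>"
  shows "(\<lambda>g. norm (\<pi> g)) \<in> borel_measurable borel"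
proof (rule borel_measurableI_le)
  fix c
  have cont: "continuous_on UNIV (\<lambda>g. \<pi> g x)" for x
    using assms by (simp add: continuous_rep_def)
  have "{g. norm (\<pi> g) \<le> c} \<in> sets borel"
  proof (cases "0 \<le> c")
    case True
    then have "norm (\<pi> g) \<le> c \<longleftrightarrow> (\<forall>x. norm (\<pi> g x) \<le> c * norm x)" for g
      using norm_blinfun_bound norm_blinfun mult_right_mono norm_ge_zero order_trans by metis
    moreover have "closed {g. \<forall>x. norm (\<pi> g x) \<le> c * norm x}"
      by (intro closed_Collect_all closed_Collect_le continuous_on_norm cont continuous_on_const)
    ultimately show ?thesis by simp
  next
    case False
    then have "\<not> norm (\<pi> g) \<le> c" for g using norm_ge_zero[of "\<pi> g"] by linarith
    then show ?thesis by simp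
  qed
  then show "{g \<in> space borel. norm (\<pi> g) \<le> c} \<in> sets borel" by simp
qed

text \<open>What strong continuity of \<open>\<pi>\<close> gives directly for the adjoints is weak
  continuity, and this suffices: the norm is controlled by the numbers
  \<open>inner (\<pi> g z) x\<close>, so its sublevel sets are again closed.\<close>

lemma norm_op_adjoint_measurable:
  fixes \<pi> :: "'g::topological_group_add \<Rightarrow> ('h::chilbert_space \<Rightarrow>\<^sub>L 'h)"
  assumes "continuous_rep \<pi>"
  shows "(\<lambda>g. norm (op_adjoint (\<pi> g) x)) \<in> borel_measurable borel"
proof (rule borel_measurableI_le)
  fix c
  have cont: "continuous_on UNIV (\<lambda>g. \<pi> g x)" for x
    using assms by (simp add: continuous_rep_def)
  have "\<pi> g \<in> bounded_ops" for g using assms by (simp add: continuous_rep_def)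
  note adjoint = inner_op_adjoint[OF this]
  have "{g. norm (op_adjoint (\<pi> g) x) \<le> c} \<in> sets borel"
  proof (cases "0 \<le> c")
    case True
    have "norm (op_adjoint (\<pi> g) x) \<le> c \<longleftrightarrow> (\<forall>z. inner (\<pi> g z) x \<le> c * norm z)" for g
    proof
      assume "norm (op_adjoint (\<pi> g) x) \<le> c"
      then show "\<forall>z. inner (\<pi> g z) x \<le> c * norm z"
        by (metis adjoint norm_cauchy_schwarz mult.commute mult_left_mono norm_ge_zero order_trans)
    next
      assume "\<forall>z. inner (\<pi> g z) x \<le> c * norm z"
      then have "(norm (op_adjoint (\<pi> g) x))\<^sup>2 \<le> c * norm (op_adjoint (\<pi> g) x)"
        by (simp add: adjoint power2_norm_eq_inner)
      then show "norm (op_adjoint (\<pi> g) x) \<le> c"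
        using True by (cases "norm (op_adjoint (\<pi> g) x) = 0") (auto simp: power2_eq_square)
    qed
    moreover have "closed {g. \<forall>z. inner (\<pi> g z) x \<le> c * norm z}"
      by (intro closed_Collect_all closed_Collect_le continuous_on_inner cont continuous_on_const)
    ultimately show ?thesis by simp
  next
    case False
    then have "\<not> norm (op_adjoint (\<pi> g) x) \<le> c" for g
      using norm_ge_zero[of "op_adjoint (\<pi> g) x"] by linarith
    then show ?thesis by simp
  qed
  then show "{g \<in> space borel. norm (op_adjoint (\<pi> g) x) \<le> c} \<in> sets borel" by simp
qed

text \<open>Each orbit map is continuous, so it is bounded on \<open>K\<close>; uniform boundedness
  then makes the bound independent of the vector.\<close>

lemma rep_bounded_on_compact:
  fixes \<pi> :: "'g::topological_group_add \<Rightarrow> ('h::chilbert_space \<Rightarrow>\<^sub>L 'h)"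
  assumes "continuous_rep \<pi>" "compact K"
  obtains c where "0 \<le> c" "\<And>g. g \<in> K \<Longrightarrow> norm (\<pi> g) \<le> c"
proof -
  have "\<exists>c. \<forall>g\<in>K. norm (\<pi> g x) \<le> c" for x
  proof -
    have "continuous_on K (\<lambda>g. \<pi> g x)"
      using assms(1) continuous_on_subset by (fastforce simp: continuous_rep_def)
    then have "bounded ((\<lambda>g. \<pi> g x) ` K)"
      using assms(2) by (intro compact_imp_bounded compact_continuous_image)
    then show ?thesis by (auto simp: bounded_iff)
  qed
  then obtain c where "\<forall>g\<in>K. norm (\<pi> g) \<le> c" using uniform_boundedness[of K \<pi>] by blast
  then show thesis by (intro that[of "max c 0"]) auto
qed

lemma set_integrable_compact:
  fixes u :: "'g::{topological_group_add, t2_space} \<Rightarrow> real"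
  assumes "right_haar_measure m" "compact K" "u \<in> borel_measurable borel" "\<And>g. g \<in> K \<Longrightarrow> \<bar>u g\<bar> \<le> c"
  shows "set_integrable m K u"
  unfolding set_integrable_def
proof (rule integrableI_bounded_set_indicator)
  show "K \<in> sets m" "u \<in> borel_measurable m"
    using assms(2,3)
    by (simp_all add: sets_haar[OF assms(1)] measurable_cong_sets[OF sets_haar[OF assms(1)] refl]
        borel_closed compact_imp_closed)
  show "emeasure m K < \<infinity>" by (rule emeasure_compact[OF assms(1,2)])
  show "AE g in m. g \<in> K \<longrightarrow> norm (u g) \<le> c" using assms(4) by auto
qed

lemma set_integral_uminus:
  fixes u :: "'g::{topological_group_add, t2_space} \<Rightarrow> real"
  assumes haar: "right_haar_measure m" and inv: "distr m m uminus = m"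
    and "uminus ` A = A" "A \<in> sets borel" "u \<in> borel_measurable borel"
  shows "(LINT g:A|m. u (- g)) = (LINT g:A|m. u g)"
proof -
  note [simp] = measurable_cong_sets[OF refl sets_haar[OF haar]]
    measurable_cong_sets[OF sets_haar[OF haar] refl]
  note [measurable] = assms(4,5)
  have A: "- g \<in> A \<longleftrightarrow> g \<in> A" for g using assms(3) by (metis image_eqI minus_minus)
  have "(LINT g:A|m. u g) = integral\<^sup>L (distr m m uminus) (\<lambda>g. indicator A g *\<^sub>R u g)"
    by (simp add: inv set_lebesgue_integral_def)
  also have "\<dots> = integral\<^sup>L m (\<lambda>g. indicator A (- g) *\<^sub>R u (- g))"
    by (rule integral_distr) simp_all
  finally show ?thesis by (simp add: set_lebesgue_integral_def indicator_def A)
qed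

lemma set_integral_right_translate:
  fixes u :: "'g::{topological_group_add, t2_space} \<Rightarrow> real"
  assumes haar: "right_haar_measure m"
    and "A \<in> sets borel" "(\<lambda>a. a + s) ` A \<in> sets borel" "u \<in> borel_measurable borel"
  shows "(LINT g:A|m. u (g + s)) = (LINT g:(\<lambda>a. a + s) ` A|m. u g)"
proof -
  note [simp] = measurable_cong_sets[OF refl sets_haar[OF haar]]
    measurable_cong_sets[OF sets_haar[OF haar] refl]
  note [measurable] = assms(2-4)
  have "(LINT g:(\<lambda>a. a + s) ` A|m. u g)
      = integral\<^sup>L (distr m m (\<lambda>g. g + s)) (\<lambda>g. indicator ((\<lambda>a. a + s) ` A) g *\<^sub>R u g)"
    by (simp add: distr_right_translate[OF haar] set_lebesgue_integral_def)
  also have "\<dots> = integral\<^sup>L m (\<lambda>g. indicator ((\<lambda>a. a + s) ` A) (g + s) *\<^sub>R u (g + s))"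
    by (rule integral_distr) simp_all
  also have "\<dots> = (LINT g:A|m. u (g + s))"
    by (simp add: set_lebesgue_integral_def indicator_def image_iff)
  finally show ?thesis ..
qed

text \<open>The integrands cancel on the intersection, so \<open>v\<close> has to dominate only on
  the symmetric difference.\<close>

lemma set_integral_sym_diff_bound:
  fixes u v :: "'a \<Rightarrow> real"
  assumes "set_integrable M A u" "set_integrable M B u" "set_integrable M (sym_diff A B) v"
    and "\<And>x. x \<in> sym_diff A B \<Longrightarrow> \<bar>u x\<bar> \<le> v x"
  shows "\<bar>(LINT x:A|M. u x) - (LINT x:B|M. u x)\<bar> \<le> (LINT x:sym_diff A B|M. v x)"
proof -
  have "\<bar>(LINT x:A|M. u x) - (LINT x:B|M. u x)\<bar>
      = norm (integral\<^sup>L M (\<lambda>x. indicator A x *\<^sub>R u x - indicator B x *\<^sub>R u x))"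
    using assms by (simp add: set_lebesgue_integral_def set_integrable_def)
  also have "\<dots> \<le> integral\<^sup>L M (\<lambda>x. indicator (sym_diff A B) x *\<^sub>R v x)"
    using assms unfolding set_integrable_def
    by (intro order_trans[OF integral_norm_bound Bochner_Integration.integral_mono]
        integrable_norm Bochner_Integration.integrable_diff)
      (auto simp: indicator_def split: if_splits)
  finally show ?thesis by (simp add: set_lebesgue_integral_def)
qed

theorem theorem2p1:
  fixes m :: "'g::{topological_group_add, t2_space} measure"
    and Q :: "'g set"
    and F :: "nat \<Rightarrow> 'g set"
    and \<pi> :: "'g \<Rightarrow> ('h::chilbert_space \<Rightarrow>\<^sub>L 'h)"
    and C :: real
  assumes "sigma_compact (UNIV :: 'g set)"
    and "locally_compact_space (euclidean :: 'g topology)"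
    and "right_haar_measure m"
    and "unimodular m"
    and "amenable m"
    and "generates_group Q"
    and "symmetric_Folner m F"
    and "continuous_rep \<pi>"
    and "\<And>g. invertible_op (\<pi> g)"
    and "C \<ge> 1"
    and "\<And>N x. N \<ge> 1 \<Longrightarrow>
           1 / measure m (F N) * (LINT g:F N|m. (norm (blinfun_apply (\<pi> g) x))\<^sup>2)
             \<le> C\<^sup>2 * (norm x)\<^sup>2"
    and "\<And>N x. N \<ge> 1 \<Longrightarrow>
           1 / measure m (F N) * (LINT g:F N|m. (norm (blinfun_apply (op_adjoint (\<pi> g)) x))\<^sup>2)
             \<le> C\<^sup>2 * (norm x)\<^sup>2"
    and "\<And>s. s \<in> Q \<Longrightarrow>
           (\<lambda>N. 1 / measure m (F N) *
                (LINT g:sym_diff ((\<lambda>a. a + s) ` F N) (F N)|m. (norm (\<pi> g))\<^sup>2))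
             \<longlonglongrightarrow> 0"
  shows "unitarizable \<pi> \<and>
         (\<exists>L. invertible_op L \<and> norm (op_inverse L) * norm L \<le> C\<^sup>2 \<and>
              unitary_rep (conj_rep L \<pi>))"
proof -
  note haar = assms(3) and rep = assms(8) and upper = assms(11) and upper_adjoint = assms(12)
  have \<pi>: "\<And>g. \<pi> g \<in> bounded_ops" "\<pi> 0 = id_blinfun" "\<And>g h x. \<pi> (g + h) x = \<pi> g (\<pi> h x)"
    and cont: "\<And>x. continuous_on UNIV (\<lambda>g. \<pi> g x)"
    using rep by (auto simp: continuous_rep_def)
  have F: "compact (F N)" "uminus ` F N = F N" "0 < emeasure m (F N)" "0 < measure m (F N)" if "N \<ge> 1" for N
    using assms(7) that by (auto simp: symmetric_Folner_def measure_def enn2real_positive_iff)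
  have F_borel: "F N \<in> sets borel" if N: "N \<ge> 1" for N
    using F(1)[OF N] by (simp add: borel_closed compact_imp_closed)
  \<comment> \<open>\<open>F 1\<close> serves as the compact set of positive measure.\<close>
  have inversion: "distr m m uminus = m"
    using distr_uminus[OF haar assms(1,2,4) F(1,3)[OF order_refl]] .

  \<comment> \<open>Measurability, and integrability over the sets of the Folner sequence\<close>
  have [measurable]: "(\<lambda>g. inner (\<pi> g x) (\<pi> g y)) \<in> borel_measurable borel"
    "(\<lambda>g. (norm (\<pi> g x))\<^sup>2) \<in> borel_measurable borel" for x y
    by (intro borel_measurable_continuous_onI continuous_on_inner continuous_on_power continuous_on_norm cont)+
  have norm_measurable [measurable]: "(\<lambda>g. (norm (\<pi> g))\<^sup>2) \<in> borel_measurable borel"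
    using norm_rep_measurable[OF rep] by simp
  have adjoint_measurable [measurable]: "(\<lambda>g. (norm (op_adjoint (\<pi> g) x))\<^sup>2) \<in> borel_measurable borel" for x
    using norm_op_adjoint_measurable[OF rep] by simp
  have norm_apply: "(norm (\<pi> g x))\<^sup>2 \<le> (norm (\<pi> g))\<^sup>2 * (norm x)\<^sup>2" for g x
    using norm_blinfun[of "\<pi> g" x] by (simp add: power_mono flip: power_mult_distrib)
  have inner_int: "set_integrable m (F N) (\<lambda>g. inner (\<pi> g x) (\<pi> g y))" if N: "N \<ge> 1" for N x y
  proof -
    obtain c where c: "0 \<le> c" "\<And>g. g \<in> F N \<Longrightarrow> norm (\<pi> g) \<le> c"
      using rep_bounded_on_compact[OF rep F(1)[OF N]] by blast
    have "\<bar>inner (\<pi> g x) (\<pi> g y)\<bar> \<le> (c * norm x) * (c * norm y)" if "g \<in> F N" for g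
    proof -
      have "norm (\<pi> g z) \<le> c * norm z" for z
        using norm_blinfun[of "\<pi> g" z] mult_right_mono[OF c(2)[OF that], of "norm z"] by simp
      then have "norm (\<pi> g x) * norm (\<pi> g y) \<le> (c * norm x) * (c * norm y)"
        using c by (intro mult_mono) auto
      then show ?thesis using Cauchy_Schwarz_ineq2[of "\<pi> g x" "\<pi> g y"] by linarith
    qed
    then show ?thesis
      by (intro set_integrable_compact[OF haar F(1)[OF N]]) auto
  qed
  have norm_int: "set_integrable m (F N) (\<lambda>g. (norm (\<pi> g x))\<^sup>2)" if N: "N \<ge> 1" for N x
    using inner_int[OF N, of x x] by (simp add: power2_norm_eq_inner)
  have adjoint_int: "set_integrable m (F N) (\<lambda>g. (norm (op_adjoint (\<pi> (- g)) x))\<^sup>2)" if N: "N \<ge> 1" for N x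
  proof -
    obtain c where c: "0 \<le> c" "\<And>g. g \<in> F N \<Longrightarrow> norm (\<pi> g) \<le> c"
      using rep_bounded_on_compact[OF rep F(1)[OF N]] by blast
    have "(norm (op_adjoint (\<pi> (- g)) x))\<^sup>2 \<le> (c * norm x)\<^sup>2" if "g \<in> F N" for g
    proof -
      have "- g \<in> F N" using that F(2)[OF N] by blast
      then have "norm (op_adjoint (\<pi> (- g))) \<le> c"
        using norm_op_adjoint_le[OF \<pi>(1)] c(2) order_trans by blast
      then have "norm (op_adjoint (\<pi> (- g)) x) \<le> c * norm x"
        using norm_blinfun[of "op_adjoint (\<pi> (- g))" x] mult_right_mono[of _ c "norm x"]
          order_trans norm_ge_zero by blast
      then show ?thesis by (intro power_mono) simp_all
    qed
    moreover have "(\<lambda>g. (norm (op_adjoint (\<pi> (- g)) x))\<^sup>2) \<in> borel_measurable borel"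
      using measurable_compose[OF translate_measurable(3) adjoint_measurable] .
    ultimately show ?thesis
      by (intro set_integrable_compact[OF haar F(1)[OF N], where c = "(c * norm x)\<^sup>2"]) auto
  qed

  \<comment> \<open>The averaged forms and their upper bound\<close>
  define \<beta> where "\<beta> N x y = 1 / measure m (F N) * (LINT g:F N|m. inner (\<pi> g x) (\<pi> g y))" for N x y
  have \<beta>_diag: "\<beta> N x x = 1 / measure m (F N) * (LINT g:F N|m. (norm (\<pi> g x))\<^sup>2)" for N x
    by (simp add: \<beta>_def power2_norm_eq_inner)
  have \<beta>_upper: "\<beta> N x x \<le> C\<^sup>2 * (norm x)\<^sup>2" if N: "N \<ge> 1" for N x
    using upper[OF N] by (simp add: \<beta>_diag)
  have \<beta>_sym: "\<beta> N x y = \<beta> N y x" for N x y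
    by (simp add: \<beta>_def inner_commute)
  have \<beta>_add: "\<beta> N (x + x') y = \<beta> N x y + \<beta> N x' y" if N: "N \<ge> 1" for N x x' y
    using inner_int[OF N] by (simp add: \<beta>_def blinfun.add_right inner_add_left set_integral_add algebra_simps)
  have \<beta>_scaleR: "\<beta> N (r *\<^sub>R x) y = r * \<beta> N x y" for N r x y
    by (simp add: \<beta>_def blinfun.scaleR_right)
  have \<beta>_ii: "\<beta> N (\<i> *\<^sub>C x) (\<i> *\<^sub>C y) = \<beta> N x y" for N x y
    using \<pi>(1) by (simp add: \<beta>_def bounded_ops_iff)
  have \<beta>_nonneg: "0 \<le> \<beta> N x x" for N x
    unfolding \<beta>_def set_lebesgue_integral_def by (intro mult_nonneg_nonneg integral_nonneg) auto
  have \<beta>_bound: "\<bar>\<beta> N x y\<bar> \<le> C\<^sup>2 * norm x * norm y" if N: "N \<ge> 1" for N x y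
  proof -
    \<comment> \<open>Cauchy-Schwarz for \<open>\<beta> N\<close>, by expanding
      \<open>\<beta> N z z \<ge> 0\<close> at \<open>z = t x - s y\<close>. Taking
      \<open>t = norm y\<close> and \<open>s\<close> of either sign with modulus
      \<open>norm x\<close> bounds the absolute value.\<close>
    have *: "s * t * \<beta> N x y \<le> C\<^sup>2 * s\<^sup>2 * t\<^sup>2" if "s\<^sup>2 = (norm x)\<^sup>2" "t\<^sup>2 = (norm y)\<^sup>2" for s t
    proof -
      define z where "z = t *\<^sub>R x + (- s) *\<^sub>R y"
      have sub: "\<beta> N u (t *\<^sub>R x + (- s) *\<^sub>R y) = t * \<beta> N u x - s * \<beta> N u y" for u
        using \<beta>_add[OF N, of "t *\<^sub>R x" "(- s) *\<^sub>R y" u] by (simp only: \<beta>_sym[of N u] \<beta>_scaleR)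
      have "0 \<le> \<beta> N z z" by (rule \<beta>_nonneg)
      also have "\<dots> = t * \<beta> N z x - s * \<beta> N z y" unfolding z_def by (rule sub)
      also have "\<dots> = t * (t * \<beta> N x x - s * \<beta> N x y) - s * (t * \<beta> N y x - s * \<beta> N y y)"
        unfolding z_def \<beta>_sym[of N "t *\<^sub>R x + (- s) *\<^sub>R y"] sub ..
      finally have "2 * (s * t * \<beta> N x y) \<le> t\<^sup>2 * \<beta> N x x + s\<^sup>2 * \<beta> N y y"
        using \<beta>_sym[of N x y] by (simp add: power2_eq_square algebra_simps)
      also have "\<dots> \<le> t\<^sup>2 * (C\<^sup>2 * (norm x)\<^sup>2) + s\<^sup>2 * (C\<^sup>2 * (norm y)\<^sup>2)"
        using \<beta>_upper[OF N] by (intro add_mono mult_left_mono) auto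
      finally show ?thesis by (simp add: that algebra_simps)
    qed
    show ?thesis
    proof (cases "x = 0 \<or> y = 0")
      case True
      then show ?thesis by (auto simp: \<beta>_def set_lebesgue_integral_def)
    next
      case False
      then have pos: "0 < norm x * norm y" by simp
      have "norm x * norm y * \<bar>\<beta> N x y\<bar> \<le> C\<^sup>2 * (norm x)\<^sup>2 * (norm y)\<^sup>2"
        using *[of "norm x" "norm y"] *[of "- norm x" "norm y"] by (simp add: abs_if)
      also have "\<dots> = norm x * norm y * (C\<^sup>2 * norm x * norm y)" by (simp add: power2_eq_square)
      finally show ?thesis by (simp only: mult_le_cancel_left_pos[OF pos])
    qed
  qed

  \<comment> \<open>The lower bound for the averaged forms\<close>
  have \<beta>_lower: "(norm x)\<^sup>2 / C\<^sup>2 \<le> \<beta> N x x" if N: "N \<ge> 1" for N x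
  proof -
    have "0 < C\<^sup>2" using assms(10) by simp
    define I where "I = (LINT g:F N|m. (norm (\<pi> g x))\<^sup>2)"
    define J where "J = (LINT g:F N|m. (norm (op_adjoint (\<pi> (- g)) x))\<^sup>2)"
    \<comment> \<open>Young's inequality with weights \<open>C\<close> and \<open>1 / C\<close>. The
      weights are chosen so that the averaged adjoint term is at most \<open>|x|^2\<close>, which
      cancels one of the two copies on the left.\<close>
    have pointwise: "2 * (norm x)\<^sup>2 \<le> C\<^sup>2 * (norm (\<pi> g x))\<^sup>2 + 1 / C\<^sup>2 * (norm (op_adjoint (\<pi> (- g)) x))\<^sup>2" for g
    proof -
      have "(norm x)\<^sup>2 = inner (\<pi> (- g) (\<pi> g x)) x"
        using \<pi>(3)[of "- g" g x] by (simp add: \<pi>(2) power2_norm_eq_inner)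
      also have "\<dots> = inner (\<pi> g x) (op_adjoint (\<pi> (- g)) x)"
        by (rule inner_op_adjoint[OF \<pi>(1)])
      finally have *: "(norm x)\<^sup>2 = inner (\<pi> g x) (op_adjoint (\<pi> (- g)) x)" .
      have "0 \<le> (norm (C *\<^sub>R \<pi> g x - (1 / C) *\<^sub>R op_adjoint (\<pi> (- g)) x))\<^sup>2" by simp
      also have "\<dots> = C\<^sup>2 * (norm (\<pi> g x))\<^sup>2 + 1 / C\<^sup>2 * (norm (op_adjoint (\<pi> (- g)) x))\<^sup>2 - 2 * (norm x)\<^sup>2"
        using assms(10) * unfolding power2_norm_eq_inner
        by (simp add: inner_diff inner_commute power2_eq_square)
      finally show ?thesis by simp
    qed
    have "2 * (norm x)\<^sup>2 * measure m (F N) = (LINT g:F N|m. 2 * (norm x)\<^sup>2)"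
      using F_borel[OF N] F(1)[OF N] by (simp add: set_lebesgue_integral_def sets_haar[OF haar])
    also have "\<dots> \<le> (LINT g:F N|m. C\<^sup>2 * (norm (\<pi> g x))\<^sup>2 + 1 / C\<^sup>2 * (norm (op_adjoint (\<pi> (- g)) x))\<^sup>2)"
      using norm_int[OF N] adjoint_int[OF N] pointwise
        set_integrable_compact[OF haar F(1)[OF N], of "\<lambda>_. 2 * (norm x)\<^sup>2" "2 * (norm x)\<^sup>2"]
      by (intro set_integral_mono set_integral_add) auto
    also have "\<dots> = C\<^sup>2 * I + 1 / C\<^sup>2 * J"
      using norm_int[OF N] adjoint_int[OF N]
      by (subst set_integral_add) (simp_all add: I_def J_def)
    finally have "2 * (norm x)\<^sup>2 \<le> C\<^sup>2 * (1 / measure m (F N) * I) + 1 / C\<^sup>2 * (1 / measure m (F N) * J)"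
      using F(4)[OF N] by (simp add: field_simps)
    \<comment> \<open>Symmetry of \<open>F N\<close> and inversion invariance of \<open>m\<close>
      replace \<open>- g\<close> by \<open>g\<close>, after which the adjoint hypothesis
      applies.\<close>
    also have "1 / measure m (F N) * J \<le> C\<^sup>2 * (norm x)\<^sup>2"
      unfolding J_def
      using upper_adjoint[OF N, of x] set_integral_uminus[OF haar inversion F(2)[OF N] F_borel[OF N] adjoint_measurable]
      by simp
    then have "1 / C\<^sup>2 * (1 / measure m (F N) * J) \<le> 1 / C\<^sup>2 * (C\<^sup>2 * (norm x)\<^sup>2)"
      by (intro mult_left_mono) auto
    finally have "(norm x)\<^sup>2 \<le> C\<^sup>2 * (1 / measure m (F N) * I)" using \<open>0 < C\<^sup>2\<close> by simp
    then show ?thesis using \<open>0 < C\<^sup>2\<close> by (simp add: \<beta>_diag I_def field_simps)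
  qed

  \<comment> \<open>The limit form\<close>
  obtain G and l :: "'h \<times> 'h \<Rightarrow> real"
    where G: "G \<le> sequentially" "G \<noteq> bot" "\<And>z. ((\<lambda>N. \<beta> N (fst z) (snd z)) \<longlongrightarrow> l z) G"
  proof (rule pointwise_cluster_point)
    show "\<bar>\<beta> N (fst z) (snd z)\<bar> \<le> C\<^sup>2 * norm (fst z) * norm (snd z)" if N: "N \<ge> 1" for N z
      by (rule \<beta>_bound[OF N])
  qed (rule that)
  \<comment> \<open>Indexing the family by pairs makes a single filter serve all vectors, so the
    identities and bounds of \<open>\<beta> N\<close> for \<open>N \<ge> 1\<close> pass to the
    limit.\<close>
  define b where "b x y = l (x, y)" for x y
  have lim: "((\<lambda>N. \<beta> N x y) \<longlongrightarrow> b x y) G" for x y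
    using G(3)[of "(x, y)"] by (simp add: b_def)
  have "\<forall>\<^sub>F N in G. N \<ge> 1"
    using G(1) eventually_ge_at_top[of 1] by (rule filter_leD)
  note ev = eventually_mono[OF this]
  have b_eqI: "p = q" if "(f \<longlongrightarrow> p) G" "(f \<longlongrightarrow> q) G" for f :: "nat \<Rightarrow> real" and p q
    using tendsto_unique[OF G(2) that] .
  have b_sym: "b x y = b y x" for x y
    using lim[of x y] lim[of y x] by (intro b_eqI) (simp_all only: \<beta>_sym[of _ x y])
  have b_add: "b (x + x') y = b x y + b x' y" for x x' y
  proof (rule b_eqI[OF lim])
    have "\<forall>\<^sub>F N in G. \<beta> N x y + \<beta> N x' y = \<beta> N (x + x') y" by (rule ev) (simp add: \<beta>_add)
    then show "((\<lambda>N. \<beta> N (x + x') y) \<longlongrightarrow> b x y + b x' y) G"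
      by (rule Lim_transform_eventually[OF tendsto_add[OF lim lim]])
  qed
  have b_scaleR: "b (r *\<^sub>R x) y = r * b x y" for r x y
    by (rule b_eqI[OF lim]) (simp only: \<beta>_scaleR, intro tendsto_mult_left lim)
  have bilinear: "bounded_bilinear b"
  proof
    show "b (x + x') y = b x y + b x' y" "b x (y + y') = b x y + b x y'"
      "b (r *\<^sub>R x) y = r *\<^sub>R b x y" "b x (r *\<^sub>R y) = r *\<^sub>R b x y" for x x' y y' r
      by (simp_all add: b_add b_scaleR b_sym[of x])
    show "\<exists>K. \<forall>x y. norm (b x y) \<le> norm x * norm y * K"
    proof (intro exI[of _ "C\<^sup>2"] allI)
      fix x y
      show "norm (b x y) \<le> norm x * norm y * C\<^sup>2"
        by (rule tendsto_upperbound[OF tendsto_norm[OF lim] _ G(2)], rule ev) (use \<beta>_bound in \<open>simp add: mult_ac\<close>)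
    qed
  qed
  have b_ii: "b (\<i> *\<^sub>C x) (\<i> *\<^sub>C y) = b x y" for x y
    using lim[of "\<i> *\<^sub>C x" "\<i> *\<^sub>C y"] lim[of x y] by (intro b_eqI) (simp_all only: \<beta>_ii)
  have b_lower: "(norm x)\<^sup>2 / C\<^sup>2 \<le> b x x" for x
    by (rule tendsto_lowerbound[OF lim _ G(2)], rule ev) (rule \<beta>_lower)
  have b_upper: "b x x \<le> C\<^sup>2 * (norm x)\<^sup>2" for x
    by (rule tendsto_upperbound[OF lim _ G(2)], rule ev) (rule \<beta>_upper)

  \<comment> \<open>Invariance of the limit form\<close>
  have invariant_Q: "b (\<pi> s x) (\<pi> s x) = b x x" if "s \<in> Q" for s x
  proof -
    define E where "E N = 1 / measure m (F N) * (LINT g:sym_diff ((\<lambda>a. a + s) ` F N) (F N)|m. (norm (\<pi> g))\<^sup>2)" for N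
    \<comment> \<open>Substituting \<open>g + s\<close> for \<open>g\<close> turns the average at
      \<open>\<pi> s x\<close> into an integral over the translate of \<open>F N\<close>. The two
      integrals differ only on the symmetric difference, where \<open>norm_apply\<close> brings in
      the operator norm.\<close>
    have bound: "\<bar>\<beta> N (\<pi> s x) (\<pi> s x) - \<beta> N x x\<bar> \<le> E N * (norm x)\<^sup>2" if N: "N \<ge> 1" for N
    proof -
      let ?Fs = "(\<lambda>a. a + s) ` F N"
      have Fs: "compact ?Fs"
        by (intro compact_continuous_image[OF continuous_on_add[OF continuous_on_id continuous_on_const]] F N)
      then have Fs_borel: "?Fs \<in> sets borel" by (simp add: borel_closed compact_imp_closed)
      obtain c where c: "0 \<le> c" "\<And>g. g \<in> ?Fs \<union> F N \<Longrightarrow> norm (\<pi> g) \<le> c"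
        using rep_bounded_on_compact[OF rep compact_Un[OF Fs F(1)[OF N]]] by blast
      \<comment> \<open>The symmetric difference need not be compact, so integrability is inherited
        from the compact union.\<close>
      have "set_integrable m (?Fs \<union> F N) (\<lambda>g. (norm (\<pi> g))\<^sup>2)"
        by (rule set_integrable_compact[OF haar compact_Un[OF Fs F(1)[OF N]] norm_measurable, where c = "c\<^sup>2"])
          (use c in \<open>simp add: power_mono\<close>)
      then have int: "set_integrable m (sym_diff ?Fs (F N)) (\<lambda>g. (norm (\<pi> g))\<^sup>2 * (norm x)\<^sup>2)"
        using Fs_borel F_borel[OF N]
        by (intro set_integrable_mult_left, elim set_integrable_subset) (auto simp: sets_haar[OF haar])
      have "set_integrable m ?Fs (\<lambda>g. (norm (\<pi> g x))\<^sup>2)"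
      proof (rule set_integrable_compact[OF haar Fs, where c = "c\<^sup>2 * (norm x)\<^sup>2"])
        fix g assume "g \<in> ?Fs"
        then have "(norm (\<pi> g))\<^sup>2 \<le> c\<^sup>2" using c(2)[of g] by (intro power_mono) auto
        then show "\<bar>(norm (\<pi> g x))\<^sup>2\<bar> \<le> c\<^sup>2 * (norm x)\<^sup>2"
          using norm_apply[of g x] mult_right_mono[of "(norm (\<pi> g))\<^sup>2" "c\<^sup>2" "(norm x)\<^sup>2"] by simp
      qed simp
      then have "\<bar>(LINT g:?Fs|m. (norm (\<pi> g x))\<^sup>2) - (LINT g:F N|m. (norm (\<pi> g x))\<^sup>2)\<bar>
          \<le> (LINT g:sym_diff ?Fs (F N)|m. (norm (\<pi> g))\<^sup>2 * (norm x)\<^sup>2)"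
        by (rule set_integral_sym_diff_bound[OF _ norm_int[OF N] int]) (simp add: norm_apply)
      also have "(LINT g:?Fs|m. (norm (\<pi> g x))\<^sup>2) = (LINT g:F N|m. (norm (\<pi> g (\<pi> s x)))\<^sup>2)"
        using set_integral_right_translate[OF haar F_borel[OF N] Fs_borel, of "\<lambda>g. (norm (\<pi> g x))\<^sup>2"]
        by (simp add: \<pi>(3))
      finally have "1 / measure m (F N) * \<bar>(LINT g:F N|m. (norm (\<pi> g (\<pi> s x)))\<^sup>2) - (LINT g:F N|m. (norm (\<pi> g x))\<^sup>2)\<bar>
          \<le> 1 / measure m (F N) * (LINT g:sym_diff ?Fs (F N)|m. (norm (\<pi> g))\<^sup>2 * (norm x)\<^sup>2)"
        by (intro mult_left_mono) simp_all
      moreover have "\<beta> N (\<pi> s x) (\<pi> s x) - \<beta> N x x = 1 / measure m (F N) *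
          ((LINT g:F N|m. (norm (\<pi> g (\<pi> s x)))\<^sup>2) - (LINT g:F N|m. (norm (\<pi> g x))\<^sup>2))"
        by (simp add: \<beta>_diag right_diff_distrib)
      ultimately show ?thesis using F(4)[OF N] by (simp add: abs_mult E_def)
    qed
    have "E \<longlonglongrightarrow> 0" unfolding E_def by (rule assms(13)[OF that])
    then have "((\<lambda>N. E N * (norm x)\<^sup>2) \<longlongrightarrow> 0) G"
      using tendsto_mono[OF G(1)] tendsto_mult_left_zero by blast
    moreover have "\<forall>\<^sub>F N in G. norm (\<beta> N (\<pi> s x) (\<pi> s x) - \<beta> N x x) \<le> E N * (norm x)\<^sup>2"
      by (rule ev) (use bound in simp)
    ultimately have "((\<lambda>N. \<beta> N (\<pi> s x) (\<pi> s x) - \<beta> N x x) \<longlongrightarrow> 0) G"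
      by (rule Lim_null_comparison[rotated])
    then have "b (\<pi> s x) (\<pi> s x) - b x x = 0"
      using tendsto_diff[OF lim lim] b_eqI by blast
    then show ?thesis by simp
  qed
  have invariant: "b (\<pi> s x) (\<pi> s x) = b x x" for s x
  proof -
    \<comment> \<open>The stabilizer of the quadratic form. For inverses, invariance under
      \<open>a\<close> is applied to the vector \<open>\<pi> (- a) x\<close>.\<close>
    define H where "H = {s. \<forall>x. b (\<pi> s x) (\<pi> s x) = b x x}"
    have "add_subgroup H"
      unfolding add_subgroup_def H_def
    proof (intro conjI ballI)
      fix a assume a: "a \<in> {s. \<forall>x. b (\<pi> s x) (\<pi> s x) = b x x}"
      have "b (\<pi> (- a) x) (\<pi> (- a) x) = b x x" for x
      proof -
        have "b (\<pi> (- a) x) (\<pi> (- a) x) = b (\<pi> a (\<pi> (- a) x)) (\<pi> a (\<pi> (- a) x))" using a by simp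
        also have "\<dots> = b x x" by (simp add: \<pi>(2) flip: \<pi>(3))
        finally show ?thesis .
      qed
      then show "- a \<in> {s. \<forall>x. b (\<pi> s x) (\<pi> s x) = b x x}" by simp
    qed (simp_all add: \<pi>)
    then have "add_subgroup hull Q \<subseteq> H"
      using invariant_Q by (intro hull_minimal) (auto simp: H_def)
    then show ?thesis using assms(6) by (auto simp: generates_group_def H_def)
  qed
  have "\<exists>L. invertible_op L \<and> norm (op_inverse L) * norm L \<le> C\<^sup>2 \<and> unitary_rep (conj_rep L \<pi>)"
    by (rule invariant_form_imp_unitary[OF rep bilinear b_sym b_ii invariant assms(10) b_lower b_upper])
  then show ?thesis by (auto simp: unitarizable_def)
qed

end
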